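(* Let $n\ge 1$ be an integer and let $m>1$, $\alpha>0$ be real constants. Then there exists $\beta_0>0$, depending only on $n$, $m$ and $\alpha$, such that for every $\beta\in(0,\beta_0]$ the following holds. Let $h,f,g:\mathbb{R}\to\mathbb{R}$ be functions of class $C^n$ such that $$\inf_{x\in\mathbb{R}}|h'(x)|\ge m,\qquad \inf_{x\in\mathbb{R}}|f'(x)|\ge\alpha,$$ $$\max\Big\{\sup_{x\in\mathbb{R}}|g'(x)|,\ \sup_{x\in\mathbb{R}}|g''(x)|,\ \dots,\ \sup_{x\in\mathbb{R}}|g^{(n)}(x)|\Big\}\le\beta,\qquad \sup_{x\in\mathbb{R}}|g(x)|<+\infty,$$ $$\max_{1\le k\le n}\Big\{\sup_{x\in\mathbb{R}}|h^{(k)}(x)|,\ \sup_{x\in\mathbb{R}}|f^{(k)}(x)|\Big\}<+\infty.$$ Then there exists a bounded function $\phi:\mathbb{R}\to\mathbb{R}$ of class $C^n$, whose derivatives $\phi',\phi'',\dots,\phi^{(n)}$ are all bounded on $\mathbb{R}$, such that $$\phi(\phi(x))=h(\phi(f(x)))+g(x)\qquad\text{for all }x\in\mathbb{R}.$$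
   Context: Here $u^{(k)}$ denotes the $k$-th derivative of a function $u:\mathbb{R}\to\mathbb{R}$. *)

theory Defs
  imports "HOL-Analysis.Analysis"
begin

text \<open>
  The \<open>k\<close>-th derivative of \<open>u\<close> is \<open>(deriv ^^ k) u\<close>. Since \<^const>\<open>deriv\<close> is total, its values are
  meaningful only under the differentiability requirements below.
\<close>

definition C_class :: "nat \<Rightarrow> (real \<Rightarrow> real) \<Rightarrow> bool" where
  "C_class n u \<longleftrightarrow>
     (\<forall>k<n. \<forall>x. (deriv ^^ k) u field_differentiable (at x)) \<and>
     continuous_on UNIV ((deriv ^^ n) u)"

end

theory Submission
  imports Defs
begin

text \<open>
  Put \<open>H = h\<inverse>\<close> and \<open>F = f\<inverse>\<close>. The equation is equivalent to the fixed point equation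
  \<open>\<phi> = H \<circ> (\<phi> \<circ> \<phi> \<circ> F - g \<circ> F)\<close>, and since \<open>H\<close> contracts, its right-hand side is a sup-norm
  contraction on bounded \<open>L\<close>-Lipschitz functions for small \<open>L\<close>. The derivatives of the Picard
  iterates converge uniformly by the fiber contraction principle. Because \<open>\<phi>\<close> is bounded, the
  functions that are not uniformly continuous are evaluated at perturbed points only inside a
  compact interval, so the limit is of class \<open>C\<^sup>1\<close>.

  For higher derivatives, \<open>U = \<phi>'\<close> solves an equation
  \<open>U = a (U \<circ> F) + b (U \<circ> G) + c (U \<circ> F) (U \<circ> G) + r\<close> with \<open>G = \<phi> \<circ> F\<close>, whose coefficients are as smooth
  as \<open>\<phi>\<close>. Its derivative solves an equation of the same shape with \<open>c = 0\<close>, so solutions are as smooth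
  as the coefficients, and the smoothness of \<open>\<phi>\<close> increases step by step up to \<open>C\<^sup>n\<close>. Contraction
  is needed only for the terms that contain the highest derivative. Their size depends on \<open>n\<close>, \<open>m\<close>
  and \<open>\<alpha>\<close> alone, which is why \<open>\<beta>\<^sub>0\<close> does.
\<close>

subsection \<open>Functions with bounded derivatives\<close>

text \<open>The bounds start at order 1 because \<open>h\<close>, \<open>f\<close> and their
  inverses are unbounded and still have to be composed with everything else.\<close>

definition bounded_derivs :: "nat \<Rightarrow> (real \<Rightarrow> real) \<Rightarrow> bool" where
  "bounded_derivs k u \<longleftrightarrow> C_class k u \<and> (\<forall>i\<in>{1..k}. bounded (range ((deriv ^^ i) u)))"

definition bounded_C :: "nat \<Rightarrow> (real \<Rightarrow> real) \<Rightarrow> bool" where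
  "bounded_C k u \<longleftrightarrow> bounded (range u) \<and> bounded_derivs k u"

lemma bounded_derivs_0: "bounded_derivs 0 u \<longleftrightarrow> continuous_on UNIV u"
  by (simp add: bounded_derivs_def C_class_def)

lemma C_class_Suc:
  "C_class (Suc k) u \<longleftrightarrow> (\<forall>x. u field_differentiable at x) \<and> C_class k (deriv u)"
  by (auto simp: C_class_def funpow_swap1 less_Suc_eq_0_disj)

text \<open>The recursion behind the inductions on the order: the derivative is itself bounded and
  so falls into \<open>bounded_C\<close>, the class that is stable under products.\<close>

lemma bounded_derivs_Suc:
  "bounded_derivs (Suc k) u \<longleftrightarrow> (\<forall>x. u field_differentiable at x) \<and> bounded_C k (deriv u)"
proof -
  have "{1..Suc k} = insert (Suc 0) (Suc ` {1..k})"
    by (auto simp: image_Suc_atLeastAtMost)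
  then show ?thesis
    by (auto simp: bounded_derivs_def bounded_C_def C_class_Suc funpow_swap1
        simp del: image_Suc_atLeastAtMost)
qed

lemma bounded_derivs_SucI:
  assumes "\<And>x. (u has_field_derivative u' x) (at x)" "bounded_C k u'"
  shows "bounded_derivs (Suc k) u"
proof -
  have "deriv u = u'"
    using assms(1) DERIV_imp_deriv by blast
  then show ?thesis
    using assms by (auto simp: bounded_derivs_Suc field_differentiable_def)
qed

lemma bounded_derivs_SucD:
  assumes "bounded_derivs (Suc k) u"
  shows "(u has_field_derivative deriv u x) (at x)" "bounded_C k (deriv u)"
  using assms by (auto simp: bounded_derivs_Suc field_differentiable_derivI)

lemma bounded_derivs_lower: "bounded_derivs (Suc k) u \<Longrightarrow> bounded_derivs k u"
proof (induction k arbitrary: u)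
  case 0
  then show ?case
    by (meson DERIV_isCont bounded_derivs_0 bounded_derivs_SucD(1) continuous_at_imp_continuous_on)
next
  case (Suc k)
  then show ?case
    by (metis bounded_C_def bounded_derivs_Suc)
qed

lemma bounded_derivs_mono: "bounded_derivs n u \<Longrightarrow> k \<le> n \<Longrightarrow> bounded_derivs k u"
  by (rotate_tac, induction rule: inc_induct) (auto intro: bounded_derivs_lower)

lemma bounded_C_mono: "bounded_C n u \<Longrightarrow> k \<le> n \<Longrightarrow> bounded_C k u"
  using bounded_C_def bounded_derivs_mono by blast

lemma bounded_C_lower: "bounded_C (Suc k) u \<Longrightarrow> bounded_C k u"
  by (simp add: bounded_C_def bounded_derivs_lower)

lemma bounded_C_SucD:
  assumes "bounded_C (Suc k) u"
  shows "(u has_field_derivative deriv u x) (at x)" "bounded_C k (deriv u)"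
  using assms bounded_derivs_SucD unfolding bounded_C_def by blast+

lemma bounded_derivs_continuous: "bounded_derivs k u \<Longrightarrow> continuous_on UNIV u"
  using bounded_derivs_0 bounded_derivs_mono by blast

section \<open>Stability under sums, products, reciprocals and composition\<close>

lemma bounded_range_iff_abs: "bounded (range (u :: real \<Rightarrow> real)) \<longleftrightarrow> (\<exists>B. \<forall>x. \<bar>u x\<bar> \<le> B)"
  by (auto simp: bounded_iff)

lemma bounded_range_abs_obtain:
  assumes "bounded (range (u :: real \<Rightarrow> real))"
  obtains B where "B \<ge> 0" "\<And>x. \<bar>u x\<bar> \<le> B"
  using assms unfolding bounded_range_iff_abs by (meson abs_ge_zero order_trans)

lemma bounded_range_add:
  fixes u v :: "real \<Rightarrow> real"
  assumes "bounded (range u)" "bounded (range v)"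
  shows "bounded (range (\<lambda>x. u x + v x))"
  using assms by (rule bounded_plus_comp)

lemma bounded_range_mult:
  fixes u v :: "real \<Rightarrow> real"
  assumes "bounded (range u)" "bounded (range v)"
  shows "bounded (range (\<lambda>x. u x * v x))"
proof -
  obtain B C where "B \<ge> 0" "\<And>x. \<bar>u x\<bar> \<le> B" "C \<ge> 0" "\<And>x. \<bar>v x\<bar> \<le> C"
    using assms bounded_range_abs_obtain by metis
  then have "\<bar>u x * v x\<bar> \<le> B * C" for x
    by (simp add: abs_mult mult_mono)
  then show ?thesis
    unfolding bounded_range_iff_abs by blast
qed

lemma bounded_range_comp:
  "bounded (range u) \<Longrightarrow> bounded (range (\<lambda>x. u (v x)))"
  by (rule bounded_subset) auto

lemma bounded_derivs_add:
  "bounded_derivs k u \<Longrightarrow> bounded_derivs k v \<Longrightarrow> bounded_derivs k (\<lambda>x. u x + v x)"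
proof (induction k arbitrary: u v)
  case 0
  then show ?case
    by (auto simp: bounded_derivs_0 intro: continuous_intros)
next
  case (Suc k)
  show ?case
  proof (rule bounded_derivs_SucI)
    show "((\<lambda>x. u x + v x) has_field_derivative deriv u x + deriv v x) (at x)" for x
      using Suc.prems by (intro DERIV_add bounded_derivs_SucD(1))
    show "bounded_C k (\<lambda>x. deriv u x + deriv v x)"
      using Suc bounded_derivs_SucD(2) by (auto simp: bounded_C_def intro: bounded_range_add)
  qed
qed

lemma bounded_C_add:
  "bounded_C k u \<Longrightarrow> bounded_C k v \<Longrightarrow> bounded_C k (\<lambda>x. u x + v x)"
  by (auto simp: bounded_C_def intro: bounded_derivs_add bounded_range_add)

text \<open>The derivative of the product contains the factors undifferentiated, which is where
  their own boundedness enters.\<close>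

lemma bounded_C_mult:
  "bounded_C k u \<Longrightarrow> bounded_C k v \<Longrightarrow> bounded_C k (\<lambda>x. u x * v x)"
proof (induction k arbitrary: u v)
  case 0
  then show ?case
    by (auto simp: bounded_C_def bounded_derivs_0 intro: continuous_intros bounded_range_mult)
next
  case (Suc k)
  note uv = Suc.prems[unfolded bounded_C_def, THEN conjunct2]
  have "bounded_derivs (Suc k) (\<lambda>x. u x * v x)"
  proof (rule bounded_derivs_SucI)
    show "((\<lambda>x. u x * v x) has_field_derivative deriv u x * v x + deriv v x * u x) (at x)" for x
      using uv by (intro DERIV_mult bounded_derivs_SucD(1))
    show "bounded_C k (\<lambda>x. deriv u x * v x + deriv v x * u x)"
      using uv Suc.prems
      by (intro bounded_C_add Suc.IH) (auto intro: bounded_derivs_SucD(2) bounded_C_lower)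
  qed
  then show ?case
    using Suc.prems by (auto simp: bounded_C_def intro: bounded_range_mult)
qed

lemma bounded_C_const: "bounded_C k (\<lambda>x. c)"
proof (induction k arbitrary: c)
  case 0
  then show ?case
    by (auto simp: bounded_C_def bounded_derivs_0)
next
  case (Suc k)
  have "bounded_derivs (Suc k) (\<lambda>x. c)"
    by (rule bounded_derivs_SucI[where u' = "\<lambda>x. 0"]) (auto intro: Suc.IH)
  then show ?case
    by (auto simp: bounded_C_def)
qed

lemma bounded_C_minus: "bounded_C k u \<Longrightarrow> bounded_C k (\<lambda>x. - u x)"
  using bounded_C_mult[OF bounded_C_const[of k "-1"]] by simp

text \<open>The derivative is a product of \<open>deriv u\<close> with two copies of the reciprocal,
  which are already under control at one order less.\<close>

lemma bounded_C_inverse: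
  assumes "\<alpha> > 0" "\<And>x. \<bar>u x\<bar> \<ge> \<alpha>" "bounded_C k u"
  shows "bounded_C k (\<lambda>x. inverse (u x))"
  using assms(3)
proof (induction k)
  have nz: "u x \<noteq> 0" for x
    using assms(1) assms(2)[of x] by auto
  have "\<bar>inverse (u x)\<bar> \<le> inverse \<alpha>" for x
    using assms(1) assms(2)[of x] by (simp add: abs_inverse le_imp_inverse_le)
  then have bdd: "bounded (range (\<lambda>x. inverse (u x)))"
    unfolding bounded_range_iff_abs by blast
  {
    case 0
    then show ?case
      using bdd nz by (auto simp: bounded_C_def bounded_derivs_0 intro: continuous_on_inverse)
  next
    case (Suc k)
    then have u: "bounded_derivs (Suc k) u" "bounded_C k (\<lambda>x. inverse (u x))"
      by (auto simp: bounded_C_def bounded_derivs_lower)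
    have "bounded_derivs (Suc k) (\<lambda>x. inverse (u x))"
    proof (rule bounded_derivs_SucI)
      show "((\<lambda>x. inverse (u x)) has_field_derivative
          - (inverse (u x) * deriv u x * inverse (u x))) (at x)" for x
        using nz u by (intro DERIV_inverse' bounded_derivs_SucD(1)) auto
      show "bounded_C k (\<lambda>x. - (inverse (u x) * deriv u x * inverse (u x)))"
        using u by (intro bounded_C_minus bounded_C_mult bounded_derivs_SucD(2))
    qed
    with bdd show ?case
      by (auto simp: bounded_C_def)
  }
qed

text \<open>\<open>deriv u\<close> stays bounded after any substitution, so an unbounded
  \<open>v\<close> does no harm. The chain rule leaves a product of one order less, with
  \<open>deriv u\<close> as the new outer function.\<close>

lemma bounded_derivs_comp:
  "bounded_derivs k u \<Longrightarrow> bounded_derivs k v \<Longrightarrow> bounded_derivs k (\<lambda>x. u (v x))"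
proof (induction k arbitrary: u)
  case 0
  then show ?case
    using continuous_on_compose2 unfolding bounded_derivs_0 by blast
next
  case (Suc k)
  show ?case
  proof (rule bounded_derivs_SucI)
    show "((\<lambda>x. u (v x)) has_field_derivative deriv u (v x) * deriv v x) (at x)" for x
      using Suc.prems by (intro DERIV_chain2 bounded_derivs_SucD(1))
    show "bounded_C k (\<lambda>x. deriv u (v x) * deriv v x)"
      using Suc bounded_derivs_SucD(2) bounded_derivs_lower
      by (intro bounded_C_mult) (auto simp: bounded_C_def intro: bounded_range_comp)
  qed
qed

lemma bounded_C_comp:
  "bounded_C k u \<Longrightarrow> bounded_derivs k v \<Longrightarrow> bounded_C k (\<lambda>x. u (v x))"
  by (auto simp: bounded_C_def intro: bounded_derivs_comp bounded_range_comp)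

section \<open>Mean value estimates and global inverses\<close>

lemma abs_diff_le_of_DERIV_bound:
  fixes u :: "real \<Rightarrow> real"
  assumes "\<And>x. (u has_field_derivative u' x) (at x)" "\<And>x. \<bar>u' x\<bar> \<le> K"
  shows "\<bar>u x - u y\<bar> \<le> K * \<bar>x - y\<bar>"
  using field_differentiable_bound[of UNIV u u' K x y] assms by simp

text \<open>The function \<open>f x - \<alpha> * x\<close> is nondecreasing, so \<open>f\<close>
  grows at least linearly in both directions and the intermediate value theorem applies.\<close>

lemma surj_of_DERIV_ge:
  fixes f :: "real \<Rightarrow> real"
  assumes "\<alpha> > 0" "\<And>x. (f has_field_derivative f' x) (at x)" "\<And>x. f' x \<ge> \<alpha>"
  shows "\<exists>x. f x = y"
proof -
  have grow: "f b - f a \<ge> \<alpha> * (b - a)" if "a \<le> b" for a b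
  proof -
    have "f b - \<alpha> * b \<ge> f a - \<alpha> * a"
    proof (rule DERIV_nonneg_imp_nondecreasing[OF that])
      show "\<exists>d. ((\<lambda>x. f x - \<alpha> * x) has_field_derivative d) (at x) \<and> 0 \<le> d" for x
        using assms(3)[of x] by (intro exI[of _ "f' x - \<alpha>"]) (auto intro!: derivative_eq_intros assms(2))
    qed
    then show ?thesis
      by (simp add: algebra_simps)
  qed
  \<comment> \<open>Half-length of an interval around 0 on which a slope of at least
    \<open>\<alpha>\<close> bridges the gap between \<open>f 0\<close> and \<open>y\<close>.\<close>
  define t where "t = \<bar>y - f 0\<bar> / \<alpha>"
  have t: "t \<ge> 0" "\<alpha> * t = \<bar>y - f 0\<bar>"
    using assms(1) by (auto simp: t_def)
  have "\<exists>x\<ge>-t. x \<le> t \<and> f x = y"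
  proof (rule IVT)
    show "f (-t) \<le> y" "y \<le> f t"
      using grow[of "-t" 0] grow[of 0 t] t by auto
    show "\<forall>x. - t \<le> x \<and> x \<le> t \<longrightarrow> isCont f x"
      using assms(2) DERIV_isCont by blast
  qed (use t in auto)
  then show ?thesis
    by blast
qed

lemma inverse_bounded_derivs:
  assumes f: "bounded_derivs n f" and n: "n \<ge> 1"
    and \<alpha>: "\<alpha> > 0" "\<And>x. \<bar>deriv f x\<bar> \<ge> \<alpha>"
  obtains F where "\<And>x. f (F x) = x" "\<And>x. F (f x) = x" "bounded_derivs n F" "\<And>x. \<bar>deriv F x\<bar> \<le> 1 / \<alpha>"
proof -
  obtain k where k: "n = Suc k"
    using n not0_implies_Suc by fastforce
  note der = bounded_derivs_SucD(1)[OF f[unfolded k]]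
  have dbdd: "bounded_C k (deriv f)"
    using f k bounded_derivs_SucD(2) by blast
  then have dcont: "continuous_on UNIV (deriv f)"
    using bounded_C_def bounded_derivs_continuous by blast
  \<comment> \<open>A change of sign would put 0 into the connected range of
    \<open>deriv f\<close>.\<close>
  have sgn: "(\<forall>x. deriv f x \<ge> \<alpha>) \<or> (\<forall>x. - deriv f x \<ge> \<alpha>)"
  proof (rule ccontr)
    assume "\<not> ?thesis"
    then obtain x y where "deriv f x < \<alpha>" "- deriv f y < \<alpha>"
      by (auto simp: not_le)
    with \<alpha>(2)[of x] \<alpha>(2)[of y] \<alpha>(1) have "deriv f x \<le> 0" "0 \<le> deriv f y"
      by linarith+
    moreover have "connected (range (deriv f))"
      using dcont connected_continuous_image connected_UNIV by blast
    ultimately have "0 \<in> range (deriv f)"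
      unfolding connected_iff_interval by blast
    then show False
      using \<alpha> by (metis abs_zero imageE not_le)
  qed
  have surj: "\<exists>x. f x = y" for y
    using sgn
  proof
    assume "\<forall>x. - deriv f x \<ge> \<alpha>"
    then have "\<exists>x. - f x = - y"
      using der by (intro surj_of_DERIV_ge[OF \<alpha>(1), where f' = "\<lambda>x. - deriv f x"] DERIV_minus) auto
    then show ?thesis
      by auto
  qed (use surj_of_DERIV_ge[OF \<alpha>(1) der] in blast)
  \<comment> \<open>This expansion makes \<open>f\<close> injective and its inverse Lipschitz, hence
    continuous, as the rule for derivatives of inverse functions requires.\<close>
  have expand: "\<alpha> * \<bar>x - y\<bar> \<le> \<bar>f x - f y\<bar>" for x y
  proof -
    have *: "\<alpha> * \<bar>x - y\<bar> \<le> \<bar>f x - f y\<bar>" if less: "x < y" for x y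
    proof -
      obtain z where "f y - f x = (y - x) * deriv f z"
        using MVT2[OF less der] by blast
      then show ?thesis
        using \<alpha>(2)[of z] less by (simp add: abs_mult abs_minus_commute[of _ "f y"] abs_minus_commute[of x y] mult.commute mult_left_mono)
    qed
    show ?thesis
      using *[of x y] *[of y x] by (cases x y rule: linorder_cases) (auto simp: abs_minus_commute)
  qed
  obtain F where F: "\<And>x. f (F x) = x"
    using surj by metis
  have Lip: "\<bar>F x - F y\<bar> \<le> (1 / \<alpha>) * \<bar>x - y\<bar>" for x y
    using expand[of "F x" "F y"] \<alpha>(1) by (simp add: F field_simps)
  have Fcont: "continuous_on UNIV F"
    by (rule lipschitz_on_continuous_on[of "1 / \<alpha>"])
      (use Lip \<alpha>(1) in \<open>auto intro!: lipschitz_onI simp: dist_real_def\<close>)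
  have Fder: "(F has_field_derivative inverse (deriv f (F x))) (at x)" for x
  proof (rule DERIV_inverse_function[where f = f and a = "x - 1" and b = "x + 1"])
    show "deriv f (F x) \<noteq> 0"
      using \<alpha> by (metis abs_zero not_le)
    show "isCont F x"
      using Fcont by (simp add: continuous_on_eq_continuous_at)
  qed (use F der in auto)
  \<comment> \<open>Bootstrap: if \<open>F\<close> has order \<open>j\<close>, so does the formula
    for its derivative, and \<open>F\<close> gains one order.\<close>
  have "bounded_derivs j F" if "j \<le> n" for j
    using that
  proof (induction j)
    case (Suc j)
    then have "j \<le> k" "bounded_derivs j F"
      using k by simp_all
    then have "bounded_C j (\<lambda>x. deriv f (F x))"
      using bounded_C_comp bounded_C_mono[OF dbdd] by blast
    then have "bounded_C j (\<lambda>x. inverse (deriv f (F x)))"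
      using bounded_C_inverse[OF \<alpha>(1) \<alpha>(2)] by blast
    with Fder show ?case
      by (rule bounded_derivs_SucI)
  qed (use Fcont in \<open>simp add: bounded_derivs_0\<close>)
  moreover have "\<bar>deriv F x\<bar> \<le> 1 / \<alpha>" for x
    using DERIV_imp_deriv[OF Fder] \<alpha>(1) \<alpha>(2)[of "F x"]
    by (simp add: abs_inverse le_imp_inverse_le divide_inverse)
  moreover have "F (f x) = x" for x
    using expand[of "F (f x)" x] \<alpha>(1) by (simp add: F mult_le_0_iff)
  ultimately show ?thesis
    using that F by blast
qed

subsection \<open>Fiber contractions\<close>

lemma abs_add3_le: "\<bar>p + q + r\<bar> \<le> \<bar>p\<bar> + \<bar>q\<bar> + \<bar>r :: real\<bar>"
  by (meson abs_triangle_ineq add_mono order_refl order_trans)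

lemma abs_add4_le: "\<bar>p + q + r + s\<bar> \<le> \<bar>p\<bar> + \<bar>q\<bar> + \<bar>r\<bar> + \<bar>s :: real\<bar>"
  by (meson abs_add3_le abs_triangle_ineq add_mono order_refl order_trans)

lemma abs_mult_diff_le:
  fixes p q r s :: real
  assumes "\<bar>p\<bar> \<le> M" "\<bar>s\<bar> \<le> M" "\<bar>p - r\<bar> \<le> e" "\<bar>q - s\<bar> \<le> e"
  shows "\<bar>p * q - r * s\<bar> \<le> 2 * M * e"
proof -
  have "p * q - r * s = p * (q - s) + (p - r) * s"
    by (simp add: algebra_simps)
  then have "\<bar>p * q - r * s\<bar> \<le> \<bar>p\<bar> * \<bar>q - s\<bar> + \<bar>p - r\<bar> * \<bar>s\<bar>"
    by (metis abs_mult abs_triangle_ineq)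
  also have "\<dots> \<le> M * e + e * M"
    using assms by (intro add_mono mult_mono) auto
  finally show ?thesis
    by simp
qed

text \<open>Turns convergence of the differentiated iterates into differentiability of the limit of
  the iterates.\<close>

lemma DERIV_uniform_limit:
  fixes u :: "nat \<Rightarrow> real \<Rightarrow> real"
  assumes der: "\<And>n x. (u n has_field_derivative u' n x) (at x)"
    and lim: "\<And>x. (\<lambda>n. u n x) \<longlonglongrightarrow> U x"
    and lim': "uniform_limit UNIV u' V sequentially"
  shows "(U has_field_derivative V x) (at x)"
proof -
  have "\<exists>g. \<forall>x\<in>UNIV. (\<lambda>n. u n x) \<longlonglongrightarrow> g x \<and> (g has_derivative (\<lambda>h. V x * h)) (at x within UNIV)"
  proof (rule has_derivative_sequence)
    show "(u n has_derivative (\<lambda>h. u' n x * h)) (at x within UNIV)" for n x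
      using der by (simp add: has_field_derivative_def)
    show "\<forall>\<^sub>F n in sequentially. \<forall>x\<in>UNIV. \<forall>h. norm (u' n x * h - V x * h) \<le> e * norm h"
      if "e > 0" for e
      using uniform_limitD[OF lim' that]
    proof eventually_elim
      case (elim n)
      show ?case
      proof (intro ballI allI)
        fix x h :: real
        have "\<bar>u' n x - V x\<bar> \<le> e"
          using elim by (auto simp: dist_real_def less_imp_le)
        then show "norm (u' n x * h - V x * h) \<le> e * norm h"
          by (simp add: abs_mult mult_right_mono flip: left_diff_distrib)
      qed
    qed
  qed (use lim in auto)
  then obtain g where g: "\<And>x. (\<lambda>n. u n x) \<longlonglongrightarrow> g x" "\<And>x. (g has_field_derivative V x) (at x)"
    unfolding has_field_derivative_def by auto
  have "g = U"
    using g(1) lim LIMSEQ_unique by blast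
  then show ?thesis
    using g(2) by simp
qed

text \<open>
  The maps \<open>T j\<close> are contractions with a common rate, but they need to converge only at the limit
  \<open>v\<close>, not uniformly on \<open>P\<close>.
\<close>

lemma fiber_contraction:
  fixes T :: "nat \<Rightarrow> ('a \<Rightarrow> real) \<Rightarrow> 'a \<Rightarrow> real"
  assumes q: "0 \<le> q" "q < 1"
    and bdd: "\<And>v x. P v \<Longrightarrow> \<bar>v x\<bar> \<le> M"
    and inv: "\<And>j v. P v \<Longrightarrow> P (T j v)"
    and contr: "\<And>j v w e x. \<lbrakk>P v; P w; \<And>x. \<bar>v x - w x\<bar> \<le> e\<rbrakk> \<Longrightarrow> \<bar>T j v x - T j w x\<bar> \<le> q * e"
    and v: "P v" "uniform_limit UNIV (\<lambda>j. T j v) v sequentially"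
    and u: "P (u 0)" "\<And>j. u (Suc j) = T j (u j)"
  shows "uniform_limit UNIV u v sequentially"
proof (rule uniform_limitI)
  fix e :: real
  assume e: "e > 0"
  have Pu: "P (u j)" for j
    by (induction j) (auto simp: u inv)
  have "\<forall>\<^sub>F j in sequentially. \<forall>x\<in>UNIV. dist (T j v x) (v x) < (1 - q) * (e / 2)"
    by (rule uniform_limitD[OF v(2)]) (use e q in auto)
  then obtain N where N: "\<And>j x. j \<ge> N \<Longrightarrow> \<bar>T j v x - v x\<bar> \<le> (1 - q) * (e / 2)"
    unfolding eventually_sequentially dist_real_def by (meson UNIV_I less_imp_le)
  \<comment> \<open>The tolerance \<open>(1 - q) * (e / 2)\<close> makes \<open>e / 2\<close>
    stationary for the error recursion, while the initial distance, at most \<open>2 * M\<close>,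
    decays geometrically.\<close>
  have est: "\<bar>u (N + i) x - v x\<bar> \<le> q ^ i * (2 * M) + e / 2" for i x
  proof (induction i arbitrary: x)
    case 0
    show ?case
      using bdd[OF Pu, of "N" x] bdd[OF v(1), of x] e by simp
  next
    case (Suc i)
    have "\<bar>u (N + Suc i) x - v x\<bar> \<le> \<bar>T (N + i) (u (N + i)) x - T (N + i) v x\<bar> + \<bar>T (N + i) v x - v x\<bar>"
      by (simp add: u)
    also have "\<dots> \<le> q * (q ^ i * (2 * M) + e / 2) + (1 - q) * (e / 2)"
      by (intro add_mono contr Pu v Suc.IH N) auto
    also have "\<dots> = q ^ Suc i * (2 * M) + e / 2"
      by (simp add: field_simps)
    finally show ?case .
  qed
  have "(\<lambda>i. q ^ i * (2 * M)) \<longlonglongrightarrow> 0"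
    by (intro tendsto_mult_left_zero LIMSEQ_power_zero) (use q in auto)
  then have "\<forall>\<^sub>F i in sequentially. q ^ i * (2 * M) < e / 2"
    using e by (intro order_tendstoD(2)) auto
  then obtain I where I: "\<And>i. i \<ge> I \<Longrightarrow> q ^ i * (2 * M) < e / 2"
    unfolding eventually_sequentially by blast
  have "dist (u n x) (v x) < e" if "n \<ge> N + I" for n x
    using est[of "n - N" x] I[of "n - N"] that by (simp add: dist_real_def) linarith
  then show "\<forall>\<^sub>F n in sequentially. \<forall>x\<in>UNIV. dist (u n x) (v x) < e"
    unfolding eventually_sequentially by blast
qed

text \<open>Banach's fixed point theorem in the sup norm, with \<open>P\<close> standing for a
  bounded set of functions closed under uniform limits. It supplies the solution
  \<open>\<phi>\<close> and the candidates for derivatives.\<close>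

lemma contraction_fixpoint:
  fixes T :: "('a \<Rightarrow> real) \<Rightarrow> 'a \<Rightarrow> real"
  assumes q: "0 \<le> q" "q < 1"
    and bdd: "\<And>v x. P v \<Longrightarrow> \<bar>v x\<bar> \<le> M"
    and closed: "\<And>w v. \<lbrakk>\<And>i. P (w i); uniform_limit UNIV w v sequentially\<rbrakk> \<Longrightarrow> P v"
    and inv: "\<And>v. P v \<Longrightarrow> P (T v)"
    and contr: "\<And>v w e x. \<lbrakk>P v; P w; \<And>x. \<bar>v x - w x\<bar> \<le> e\<rbrakk> \<Longrightarrow> \<bar>T v x - T w x\<bar> \<le> q * e"
    and v0: "P v0"
  shows "\<exists>v. P v \<and> T v = v"
proof -
  define w where "w i = (T ^^ i) v0" for i
  have w_Suc: "w (Suc i) = T (w i)" for i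
    by (simp add: w_def)
  have Pw: "P (w i)" for i
    by (induction i) (auto simp: w_def v0 inv)
  \<comment> \<open>Going back \<open>i\<close> steps leaves the distance between \<open>w k\<close>
    and \<open>w 0\<close>, at most \<open>2 * M\<close> for every \<open>k\<close>, so no geometric
    series has to be summed.\<close>
  have est: "\<bar>w (i + k) x - w i x\<bar> \<le> q ^ i * (2 * M)" for i k x
  proof (induction i arbitrary: x)
    case 0
    show ?case
      using bdd[OF Pw, of k x] bdd[OF Pw, of 0 x] by simp
  next
    case (Suc i)
    have "\<bar>T (w (i + k)) x - T (w i) x\<bar> \<le> q * (q ^ i * (2 * M))"
      by (intro contr Pw Suc.IH)
    then show ?case
      by (simp add: w_Suc mult.assoc)
  qed
  have "uniformly_Cauchy_on UNIV w"
  proof (rule uniformly_Cauchy_onI')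
    fix e :: real
    assume e: "e > 0"
    have "(\<lambda>i. q ^ i * (2 * M)) \<longlonglongrightarrow> 0"
      by (intro tendsto_mult_left_zero LIMSEQ_power_zero) (use q in auto)
    then have "\<forall>\<^sub>F i in sequentially. q ^ i * (2 * M) < e"
      using e by (intro order_tendstoD(2)) auto
    then obtain I where I: "\<And>i. i \<ge> I \<Longrightarrow> q ^ i * (2 * M) < e"
      unfolding eventually_sequentially by blast
    have "dist (w i x) (w n x) < e" if "i \<ge> I" "n > i" for i n x
      using est[of i "n - i" x] I[OF that(1)] that(2) by (auto simp: dist_real_def abs_minus_commute)
    then show "\<exists>I. \<forall>x\<in>UNIV. \<forall>i\<ge>I. \<forall>n>i. dist (w i x) (w n x) < e"
      by blast
  qed
  then obtain v where v: "uniform_limit UNIV w v sequentially"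
    using uniformly_convergent_eq_Cauchy uniformly_convergent_on_def by blast
  have Pv: "P v"
    using closed Pw v by blast
  have "T v x = v x" for x
  proof -
    have "(\<lambda>i. w (Suc i) x) \<longlonglongrightarrow> v x"
      using tendsto_uniform_limitI[OF v] LIMSEQ_Suc by blast
    \<comment> \<open>The contraction estimate makes \<open>T\<close> continuous at
      \<open>v\<close>, so the shifted sequence also tends to \<open>T v\<close>.\<close>
    moreover have "(\<lambda>i. w (Suc i) x) \<longlonglongrightarrow> T v x"
    proof (rule LIMSEQ_I)
      fix e :: real
      assume e: "e > 0"
      from uniform_limitD[OF v, of "e"] e
      obtain I where I: "\<And>i x. i \<ge> I \<Longrightarrow> \<bar>w i x - v x\<bar> \<le> e"
        unfolding eventually_sequentially dist_real_def by (meson UNIV_I less_imp_le)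
      have "norm (w (Suc i) x - T v x) < e" if "i \<ge> I" for i
      proof -
        have "\<bar>w (Suc i) x - T v x\<bar> \<le> q * e"
          unfolding w_Suc by (intro contr Pw Pv I that)
        also have "\<dots> < e"
          using q e by simp
        finally show ?thesis
          by simp
      qed
      then show "\<exists>I. \<forall>i\<ge>I. norm (w (Suc i) x - T v x) < e"
        by blast
    qed
    ultimately show ?thesis
      using LIMSEQ_unique by blast
  qed
  then have "T v = v"
    by blast
  with Pv show ?thesis
    by blast
qed

subsection \<open>Regularity for a quadratic functional equation\<close>

text \<open>\<open>U\<close> is recovered as the uniform limit of differentiable Picard iterates
  started at 0. Their derivatives converge, by fiber contraction, to a solution of the formally
  differentiated equation.\<close>

lemma quadratic_equation_C1:
  fixes a b c r F G U :: "real \<Rightarrow> real"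
  assumes q: "q < 1" and A: "1 \<le> A"
    and U: "\<And>x. U x = a x * U (F x) + b x * U (G x) + c x * (U (F x) * U (G x)) + r x"
    and M: "\<And>x. \<bar>U x\<bar> \<le> M"
    and ball: "\<And>x. \<bar>a x\<bar> * M + \<bar>b x\<bar> * M + \<bar>c x\<bar> * (M * M) + \<bar>r x\<bar> \<le> M"
    and small: "\<And>x. (\<bar>a x\<bar> + \<bar>b x\<bar> + 2 * M * \<bar>c x\<bar>) * A \<le> q"
    and coeffs: "bounded_C (Suc 0) a" "bounded_C (Suc 0) b" "bounded_C (Suc 0) c" "bounded_C (Suc 0) r"
    and F: "bounded_derivs (Suc 0) F" "\<And>x. \<bar>deriv F x\<bar> \<le> A"
    and G: "bounded_derivs (Suc 0) G" "\<And>x. \<bar>deriv G x\<bar> \<le> A"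
  obtains V where "\<And>x. (U has_field_derivative V x) (at x)" "bounded_C 0 V"
    "\<And>x. V x = (a x + c x * U (G x)) * deriv F x * V (F x)
      + (b x + c x * U (F x)) * deriv G x * V (G x)
      + (deriv a x * U (F x) + deriv b x * U (G x) + deriv c x * (U (F x) * U (G x)) + deriv r x)"
proof -
  have M0: "M \<ge> 0"
    using M[of 0] by simp
  \<comment> \<open>As \<open>A\<close> is at least 1, the rate \<open>q\<close> for the derivatives
    also serves for the functions.\<close>
  have small1: "\<bar>a x\<bar> + \<bar>b x\<bar> + 2 * M * \<bar>c x\<bar> \<le> q" for x
  proof -
    have "\<bar>a x\<bar> + \<bar>b x\<bar> + 2 * M * \<bar>c x\<bar> \<le> (\<bar>a x\<bar> + \<bar>b x\<bar> + 2 * M * \<bar>c x\<bar>) * A"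
      using mult_left_mono[OF A, of "\<bar>a x\<bar> + \<bar>b x\<bar> + 2 * M * \<bar>c x\<bar>"] M0 by simp
    then show ?thesis
      using small[of x] by simp
  qed
  have q0: "q \<ge> 0"
    using small1[of 0] M0 by (smt (verit) abs_ge_zero mult_nonneg_nonneg)
  \<comment> \<open>\<open>Q\<close> is the right-hand side as an operator, and \<open>L w z\<close>
    is the derivative of \<open>Q w\<close> when \<open>z\<close> is that of \<open>w\<close>. Hence
    \<open>u j\<close> are the Picard iterates and \<open>v j\<close> their derivatives.\<close>
  define Q where "Q u x = a x * u (F x) + b x * u (G x) + c x * (u (F x) * u (G x)) + r x" for u x
  define L where "L u v x = (a x + c x * u (G x)) * deriv F x * v (F x)
      + (b x + c x * u (F x)) * deriv G x * v (G x)
      + (deriv a x * u (F x) + deriv b x * u (G x) + deriv c x * (u (F x) * u (G x)) + deriv r x)"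
    for u v x
  define u where "u j = (Q ^^ j) (\<lambda>_. 0)" for j
  define v where "v = rec_nat (\<lambda>_. 0) (\<lambda>j. L (u j))"
  have u_Suc: "u (Suc j) = Q (u j)" for j
    by (simp add: u_def)
  have v_Suc: "v (Suc j) = L (u j) (v j)" for j
    by (simp add: v_def)
  have QM: "\<bar>Q w x\<bar> \<le> M" if w: "\<And>x. \<bar>w x\<bar> \<le> M" for w x
  proof -
    have "\<bar>Q w x\<bar> \<le> \<bar>a x\<bar> * \<bar>w (F x)\<bar> + \<bar>b x\<bar> * \<bar>w (G x)\<bar> + \<bar>c x\<bar> * (\<bar>w (F x)\<bar> * \<bar>w (G x)\<bar>) + \<bar>r x\<bar>"
      unfolding Q_def abs_mult[symmetric] by (rule abs_add4_le)
    also have "\<dots> \<le> \<bar>a x\<bar> * M + \<bar>b x\<bar> * M + \<bar>c x\<bar> * (M * M) + \<bar>r x\<bar>"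
      using M0 by (intro add_mono mult_left_mono mult_mono w) auto
    finally show ?thesis
      using ball[of x] by simp
  qed
  have uM: "\<bar>u j x\<bar> \<le> M" for j x
    by (induction j arbitrary: x) (auto simp: u_Suc QM M0, simp add: u_def M0)
  \<comment> \<open>For a constant family of operators, fiber contraction is convergence of the
    Picard iterates to the given fixed point.\<close>
  have uU: "uniform_limit UNIV u U sequentially"
  proof (rule fiber_contraction[where T = "\<lambda>_. Q" and P = "\<lambda>w. \<forall>x. \<bar>w x\<bar> \<le> M" and M = M, OF q0 q])
    fix w w' :: "real \<Rightarrow> real" and e x
    assume ww: "\<forall>x. \<bar>w x\<bar> \<le> M" "\<forall>x. \<bar>w' x\<bar> \<le> M" "\<And>x. \<bar>w x - w' x\<bar> \<le> e"
    have e: "e \<ge> 0"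
      using ww(3)[of 0] by simp
    have "Q w x - Q w' x = a x * (w (F x) - w' (F x)) + b x * (w (G x) - w' (G x))
        + c x * (w (F x) * w (G x) - w' (F x) * w' (G x))"
      by (simp add: Q_def algebra_simps)
    also have "\<bar>\<dots>\<bar> \<le> \<bar>a x\<bar> * \<bar>w (F x) - w' (F x)\<bar> + \<bar>b x\<bar> * \<bar>w (G x) - w' (G x)\<bar>
        + \<bar>c x\<bar> * \<bar>w (F x) * w (G x) - w' (F x) * w' (G x)\<bar>"
      unfolding abs_mult[symmetric] by (rule abs_add3_le)
    also have "\<dots> \<le> \<bar>a x\<bar> * e + \<bar>b x\<bar> * e + \<bar>c x\<bar> * (2 * M * e)"
      using ww by (intro add_mono mult_left_mono abs_mult_diff_le) auto
    also have "\<dots> = (\<bar>a x\<bar> + \<bar>b x\<bar> + 2 * M * \<bar>c x\<bar>) * e"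
      by (simp add: algebra_simps)
    also have "\<dots> \<le> q * e"
      by (rule mult_right_mono[OF small1 e])
    finally show "\<bar>Q w x - Q w' x\<bar> \<le> q * e" .
  next
    have "Q U = U"
      unfolding Q_def by (rule ext, rule U[symmetric])
    then show "uniform_limit UNIV (\<lambda>j. Q U) U sequentially"
      by (simp add: uniform_limit_const)
    show "\<forall>x. \<bar>Q w x\<bar> \<le> M" if "\<forall>x. \<bar>w x\<bar> \<le> M" for w
      using that by (blast intro: QM)
  qed (simp_all add: M uM u_Suc)

  have der: "(a has_field_derivative deriv a x) (at x)" "(b has_field_derivative deriv b x) (at x)"
    "(c has_field_derivative deriv c x) (at x)" "(r has_field_derivative deriv r x) (at x)"
    "(F has_field_derivative deriv F x) (at x)" "(G has_field_derivative deriv G x) (at x)" for x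
    by (rule bounded_C_SucD(1) bounded_derivs_SucD(1) coeffs F(1) G(1))+
  have bdd_der: "bounded_C 0 (deriv a)" "bounded_C 0 (deriv b)" "bounded_C 0 (deriv c)" "bounded_C 0 (deriv r)"
    "bounded_C 0 (deriv F)" "bounded_C 0 (deriv G)"
    by (rule bounded_C_SucD(2) bounded_derivs_SucD(2) coeffs F(1) G(1))+
  have bdd0: "bounded_C 0 a" "bounded_C 0 b" "bounded_C 0 c" "bounded_C 0 r"
    "bounded_derivs 0 F" "bounded_derivs 0 G"
    by (rule coeffs F(1) G(1) bounded_C_lower bounded_derivs_lower)+
  have uder: "(u j has_field_derivative v j x) (at x)" for j x
  proof (induction j arbitrary: x)
    case 0
    then show ?case
      by (simp add: u_def v_def)
  next
    case (Suc j)
    note chain = DERIV_chain2[OF Suc.IH der(5)] DERIV_chain2[OF Suc.IH der(6)]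
    show ?case
      unfolding u_Suc v_Suc Q_def[abs_def] L_def
      by (rule DERIV_cong[OF DERIV_add[OF DERIV_add[OF DERIV_add[OF
                DERIV_mult[OF der(1) chain(1)] DERIV_mult[OF der(2) chain(2)]]
                DERIV_mult[OF der(3) DERIV_mult[OF chain]]] der(4)]])
        (simp add: algebra_simps)
  qed
  have uC: "bounded_C 0 (u j)" for j
    unfolding bounded_C_def bounded_derivs_0 bounded_range_iff_abs
    using DERIV_isCont[OF uder] uM by (blast intro: continuous_at_imp_continuous_on)
  have vC: "bounded_C 0 (v j)" for j
  proof (induction j)
    case 0
    show ?case
      using bounded_C_const[of 0 0] by (simp add: v_def)
  next
    case (Suc j)
    show ?case
      unfolding v_Suc L_def[abs_def]
      by (intro bounded_C_add bounded_C_mult bounded_C_comp[OF uC] bounded_C_comp[OF Suc.IH] bdd_der bdd0)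
  qed
  define rem where "rem w x = deriv a x * w (F x) + deriv b x * w (G x) + deriv c x * (w (F x) * w (G x)) + deriv r x" for w x
  have "\<exists>K\<ge>0. \<forall>x. \<bar>w x\<bar> \<le> K" if "bounded_C 0 w" for w
    using that bounded_range_abs_obtain unfolding bounded_C_def by blast
  then obtain Ka Kb Kc Kr where K: "Ka \<ge> 0" "\<And>x. \<bar>deriv a x\<bar> \<le> Ka" "Kb \<ge> 0" "\<And>x. \<bar>deriv b x\<bar> \<le> Kb"
    "Kc \<ge> 0" "\<And>x. \<bar>deriv c x\<bar> \<le> Kc" "Kr \<ge> 0" "\<And>x. \<bar>deriv r x\<bar> \<le> Kr"
    using bdd_der(1-4) by meson
  define K where "K = Ka * M + Kb * M + Kc * (M * M) + Kr"
  have K0: "K \<ge> 0"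
    using K M0 by (simp add: K_def)
  have remK: "\<bar>rem w x\<bar> \<le> K" if w: "\<And>x. \<bar>w x\<bar> \<le> M" for w x
  proof -
    have "\<bar>rem w x\<bar> \<le> \<bar>deriv a x\<bar> * \<bar>w (F x)\<bar> + \<bar>deriv b x\<bar> * \<bar>w (G x)\<bar>
        + \<bar>deriv c x\<bar> * (\<bar>w (F x)\<bar> * \<bar>w (G x)\<bar>) + \<bar>deriv r x\<bar>"
      unfolding rem_def abs_mult[symmetric] by (rule abs_add4_le)
    also have "\<dots> \<le> K"
      unfolding K_def using M0 K by (intro add_mono mult_mono w) auto
    finally show ?thesis .
  qed
  \<comment> \<open>Solves \<open>q * M' + K = M'\<close>, so that \<open>L w\<close> preserves the
    ball of radius \<open>M'\<close> whenever \<open>w\<close> is bounded by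
    \<open>M\<close>.\<close>
  define M' where "M' = K / (1 - q)"
  have M': "M' \<ge> 0" "q * M' + K = M'"
    using K0 q by (auto simp: M'_def field_simps)
  \<comment> \<open>The two contributions \<open>M * \<bar>c x\<bar>\<close> add up to the term
    \<open>2 * M * \<bar>c x\<bar>\<close> of the smallness condition, and \<open>A\<close> absorbs
    the derivatives of \<open>F\<close> and \<open>G\<close>.\<close>
  have lin: "\<bar>(a x + c x * w (G x)) * deriv F x * y + (b x + c x * w (F x)) * deriv G x * z\<bar> \<le> q * e"
    if w: "\<And>x. \<bar>w x\<bar> \<le> M" and yz: "\<bar>y\<bar> \<le> e" "\<bar>z\<bar> \<le> e" for w x y z e
  proof -
    have e: "e \<ge> 0"
      using yz(1) by linarith
    have cf: "\<bar>d x + c x * w z\<bar> \<le> \<bar>d x\<bar> + M * \<bar>c x\<bar>" for z and d :: "real \<Rightarrow> real"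
    proof -
      have "\<bar>c x\<bar> * \<bar>w z\<bar> \<le> M * \<bar>c x\<bar>"
        using mult_left_mono[OF w, of "\<bar>c x\<bar>"] by (simp add: mult.commute)
      then show ?thesis
        using abs_triangle_ineq[of "d x" "c x * w z"] by (simp add: abs_mult)
    qed
    have "\<bar>(a x + c x * w (G x)) * deriv F x * y + (b x + c x * w (F x)) * deriv G x * z\<bar>
      \<le> \<bar>a x + c x * w (G x)\<bar> * \<bar>deriv F x\<bar> * \<bar>y\<bar> + \<bar>b x + c x * w (F x)\<bar> * \<bar>deriv G x\<bar> * \<bar>z\<bar>"
      unfolding abs_mult[symmetric] by (rule abs_triangle_ineq)
    also have "\<dots> \<le> (\<bar>a x\<bar> + M * \<bar>c x\<bar>) * A * e + (\<bar>b x\<bar> + M * \<bar>c x\<bar>) * A * e"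
      using A M0 by (intro add_mono mult_mono cf F G yz) auto
    also have "\<dots> = (\<bar>a x\<bar> + \<bar>b x\<bar> + 2 * M * \<bar>c x\<bar>) * A * e"
      by (simp add: algebra_simps)
    also have "\<dots> \<le> q * e"
      by (rule mult_right_mono[OF small e])
    finally show ?thesis .
  qed
  have L_rem: "L w z x = ((a x + c x * w (G x)) * deriv F x * z (F x)
      + (b x + c x * w (F x)) * deriv G x * z (G x)) + rem w x" for w z x
    by (simp add: L_def rem_def)
  have LM: "\<bar>L w z x\<bar> \<le> M'" if "\<And>x. \<bar>w x\<bar> \<le> M" "\<And>x. \<bar>z x\<bar> \<le> M'" for w z x
    using lin[of w "z (F x)" M' "z (G x)" x] remK[of w x] that M'(2) unfolding L_rem by force
  have Lcontr: "\<bar>L w y x - L w z x\<bar> \<le> q * e" if "\<And>x. \<bar>w x\<bar> \<le> M" "\<And>x. \<bar>y x - z x\<bar> \<le> e" for w y z e x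
  proof -
    have "L w y x - L w z x = (a x + c x * w (G x)) * deriv F x * (y (F x) - z (F x))
      + (b x + c x * w (F x)) * deriv G x * (y (G x) - z (G x))"
      by (simp add: L_rem algebra_simps)
    then show ?thesis
      using lin[of w "y (F x) - z (F x)" e "y (G x) - z (G x)" x] that by simp
  qed
  \<comment> \<open>The candidate for the derivative, constructed before \<open>U\<close> is known
    to be differentiable.\<close>
  have "\<exists>V. (\<forall>x. \<bar>V x\<bar> \<le> M') \<and> L U V = V"
  proof (rule contraction_fixpoint[where T = "L U" and P = "\<lambda>w. \<forall>x. \<bar>w x\<bar> \<le> M'" and M = M' and ?v0.0 = "\<lambda>_. 0", OF q0 q])
    fix w :: "nat \<Rightarrow> real \<Rightarrow> real" and z
    assume w: "\<And>i. \<forall>x. \<bar>w i x\<bar> \<le> M'" "uniform_limit UNIV w z sequentially"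
    show "\<forall>x. \<bar>z x\<bar> \<le> M'"
    proof
      fix x
      have "(\<lambda>i. \<bar>w i x\<bar>) \<longlonglongrightarrow> \<bar>z x\<bar>"
        using tendsto_uniform_limitI[OF w(2)] by (intro tendsto_rabs) auto
      then show "\<bar>z x\<bar> \<le> M'"
        using w(1) by (intro LIMSEQ_le_const2) auto
    qed
  next
    show "\<forall>x. \<bar>L U w x\<bar> \<le> M'" if "\<forall>x. \<bar>w x\<bar> \<le> M'" for w
      using that M by (blast intro: LM)
    show "\<bar>L U y x - L U z x\<bar> \<le> q * e" if "\<And>x. \<bar>y x - z x\<bar> \<le> e" for y z e x
      by (rule Lcontr[OF M that])
  qed (use M' in simp_all)
  then obtain V where V: "\<forall>x. \<bar>V x\<bar> \<le> M'" "L U V = V"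
    by blast
  have Ubd: "bounded (range U)"
    using M bounded_range_iff_abs by blast
  have Vbd: "bounded (range V)"
    using V(1) bounded_range_iff_abs by blast
  have ucomp: "uniform_limit UNIV (\<lambda>j x. u j (\<psi> x)) (\<lambda>x. U (\<psi> x)) sequentially" for \<psi> :: "real \<Rightarrow> real"
    using uniform_limit_compose'[OF uU] by auto
  have vV: "uniform_limit UNIV v V sequentially"
  proof (rule fiber_contraction[where T = "\<lambda>j. L (u j)" and P = "\<lambda>w. \<forall>x. \<bar>w x\<bar> \<le> M'" and M = M', OF q0 q])
    \<comment> \<open>Here \<open>V\<close> is evaluated only at \<open>F x\<close> and
      \<open>G x\<close>, which do not move with \<open>j\<close>, so uniform convergence of
      \<open>u\<close> and boundedness suffice.\<close>
    have "uniform_limit UNIV (\<lambda>j. L (u j) V) (L U V) sequentially"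
      unfolding L_def[abs_def]
      by (intro uniform_limit_add uniform_lim_mult ucomp uniform_limit_const
          bounded_range_add bounded_range_mult bounded_range_comp[OF Ubd] bounded_range_comp[OF Vbd]
          bdd_der[unfolded bounded_C_def, THEN conjunct1] bdd0(1-4)[unfolded bounded_C_def, THEN conjunct1])
    then show "uniform_limit UNIV (\<lambda>j. L (u j) V) V sequentially"
      unfolding V(2) .
    show "\<forall>x. \<bar>v 0 x\<bar> \<le> M'"
      using M' by (simp add: v_def)
    show "\<forall>x. \<bar>L (u j) w x\<bar> \<le> M'" if "\<forall>x. \<bar>w x\<bar> \<le> M'" for j w
      using that uM by (blast intro: LM)
    show "\<bar>L (u j) y x - L (u j) z x\<bar> \<le> q * e" if "\<And>x. \<bar>y x - z x\<bar> \<le> e" for j y z e x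
      by (rule Lcontr[OF uM that])
  qed (simp_all add: V(1) v_Suc)
  have "(U has_field_derivative V x) (at x)" for x
    using DERIV_uniform_limit[OF uder _ vV] tendsto_uniform_limitI[OF uU] by blast
  moreover have "continuous_on UNIV V"
    using vC by (intro uniform_limit_theorem[OF _ vV]) (auto simp: bounded_C_def bounded_derivs_0)
  then have "bounded_C 0 V"
    using Vbd by (simp add: bounded_C_def bounded_derivs_0)
  moreover have "V x = L U V x" for x
    using V(2) by simp
  ultimately show ?thesis
    using that unfolding L_def by blast
qed

text \<open>
  Each differentiation multiplies the coefficients of the leading terms by \<open>F'\<close> or \<open>G'\<close>, hence the
  factor \<open>A ^ k\<close> in the smallness condition. The bound involving \<open>M\<close> and \<open>r\<close> makes the ball of radius
  \<open>M\<close> invariant under the Picard iteration.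
\<close>

lemma quadratic_equation_regularity:
  fixes a b c r F G U :: "real \<Rightarrow> real"
  assumes "q < 1" "1 \<le> A" "continuous_on UNIV U"
    and "\<And>x. U x = a x * U (F x) + b x * U (G x) + c x * (U (F x) * U (G x)) + r x"
    and "\<And>x. \<bar>U x\<bar> \<le> M"
    and "\<And>x. \<bar>a x\<bar> * M + \<bar>b x\<bar> * M + \<bar>c x\<bar> * (M * M) + \<bar>r x\<bar> \<le> M"
    and "\<And>x. (\<bar>a x\<bar> + \<bar>b x\<bar> + 2 * M * \<bar>c x\<bar>) * A ^ k \<le> q"
    and "bounded_C k a" "bounded_C k b" "bounded_C k c" "bounded_C k r"
    and "bounded_derivs k F" "\<And>x. \<bar>deriv F x\<bar> \<le> A"
    and "bounded_derivs k G" "\<And>x. \<bar>deriv G x\<bar> \<le> A"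
  shows "bounded_derivs k U"
  using assms
proof (induction k arbitrary: U a b c r M)
  case 0
  show ?case
    using "0.prems"(3) by (simp add: bounded_derivs_0)
next
  case (Suc k)
  note q = Suc.prems(1) and A = Suc.prems(2) and U = Suc.prems(4) and M = Suc.prems(5)
    and ball = Suc.prems(6) and small = Suc.prems(7) and coeffs = Suc.prems(8-11)
    and F = Suc.prems(12,13) and G = Suc.prems(14,15)
  have M0: "M \<ge> 0"
    using M[of 0] by simp
  \<comment> \<open>The condition at \<open>A ^ Suc k\<close> passes to smaller powers; the powers
    0, 1 and \<open>k\<close> are used below.\<close>
  have pow: "s * A ^ i \<le> q" if "s * A ^ Suc k \<le> q" "i \<le> Suc k" "s \<ge> 0" for s i
    using mult_left_mono[OF power_increasing[OF that(2) A] that(3)] that(1) by linarith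
  have s0: "\<bar>a x\<bar> + \<bar>b x\<bar> + 2 * M * \<bar>c x\<bar> \<ge> 0" for x
    using M0 by simp
  have q0: "q \<ge> 0"
    using pow[OF small, of 0] s0 by (metis le0 mult.right_neutral order_trans power_0)
  have low: "bounded_C k a" "bounded_C k b" "bounded_C k c" "bounded_C k r"
    "bounded_derivs k F" "bounded_derivs k G"
    by (rule coeffs F(1) G(1) bounded_C_lower bounded_derivs_lower)+
  \<comment> \<open>First use of the induction hypothesis: the coefficients of the equation for
    \<open>V\<close> contain \<open>U\<close>, which therefore has to reach order \<open>k\<close>
    beforehand.\<close>
  have Uk: "bounded_derivs k U"
    using Suc.IH[OF q A Suc.prems(3) U M ball pow[OF small] low(1-5) F(2) low(6) G(2)] s0 by simp
  moreover have Ubd: "bounded (range U)"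
    using M bounded_range_iff_abs by blast
  ultimately have UC: "bounded_C k U"
    by (simp add: bounded_C_def)
  have low1: "bounded_C (Suc 0) a" "bounded_C (Suc 0) b" "bounded_C (Suc 0) c" "bounded_C (Suc 0) r"
    "bounded_derivs (Suc 0) F" "bounded_derivs (Suc 0) G"
    by (rule coeffs[THEN bounded_C_mono] F(1)[THEN bounded_derivs_mono] G(1)[THEN bounded_derivs_mono], simp)+
  obtain V where Vder: "\<And>x. (U has_field_derivative V x) (at x)" and VC: "bounded_C 0 V" and
    V: "\<And>x. V x = (a x + c x * U (G x)) * deriv F x * V (F x)
      + (b x + c x * U (F x)) * deriv G x * V (G x)
      + (deriv a x * U (F x) + deriv b x * U (G x) + deriv c x * (U (F x) * U (G x)) + deriv r x)"
  proof (rule quadratic_equation_C1[OF q A U M ball _ low1(1-5) F(2) low1(6) G(2)])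
    show "(\<bar>a x\<bar> + \<bar>b x\<bar> + 2 * M * \<bar>c x\<bar>) * A \<le> q" for x
      using pow[OF small, of 1] s0 by simp
  qed (rule that)
  \<comment> \<open>The equation for \<open>V\<close> is affine, so it has the required shape with
    quadratic coefficient 0.\<close>
  define a' where "a' x = (a x + c x * U (G x)) * deriv F x" for x
  define b' where "b' x = (b x + c x * U (F x)) * deriv G x" for x
  define r' where "r' x = deriv a x * U (F x) + deriv b x * U (G x) + deriv c x * (U (F x) * U (G x)) + deriv r x" for x
  have der: "bounded_C k (deriv a)" "bounded_C k (deriv b)" "bounded_C k (deriv c)" "bounded_C k (deriv r)"
    "bounded_C k (deriv F)" "bounded_C k (deriv G)"
    by (rule bounded_C_SucD(2) bounded_derivs_SucD(2) coeffs F(1) G(1))+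
  have C': "bounded_C k a'" "bounded_C k b'" "bounded_C k r'"
    unfolding a'_def[abs_def] b'_def[abs_def] r'_def[abs_def]
    by (intro bounded_C_add bounded_C_mult bounded_C_comp[OF UC] der low)+
  \<comment> \<open>One factor \<open>A\<close> is spent here, leaving \<open>A ^ k\<close> out of
    \<open>A ^ Suc k\<close> for the induction hypothesis.\<close>
  have coeff': "\<bar>a' x\<bar> + \<bar>b' x\<bar> \<le> (\<bar>a x\<bar> + \<bar>b x\<bar> + 2 * M * \<bar>c x\<bar>) * A" for x
  proof -
    have cf: "\<bar>d x + c x * U z\<bar> \<le> \<bar>d x\<bar> + M * \<bar>c x\<bar>" for z and d :: "real \<Rightarrow> real"
    proof -
      have "\<bar>c x\<bar> * \<bar>U z\<bar> \<le> M * \<bar>c x\<bar>"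
        using mult_left_mono[OF M, of "\<bar>c x\<bar>"] by (simp add: mult.commute)
      then show ?thesis
        using abs_triangle_ineq[of "d x" "c x * U z"] by (simp add: abs_mult)
    qed
    have "\<bar>a' x\<bar> + \<bar>b' x\<bar> \<le> (\<bar>a x\<bar> + M * \<bar>c x\<bar>) * A + (\<bar>b x\<bar> + M * \<bar>c x\<bar>) * A"
      unfolding a'_def b'_def abs_mult
      using M0 by (intro add_mono mult_mono cf F G) auto
    then show ?thesis
      by (simp add: algebra_simps)
  qed
  obtain N where N: "N \<ge> 0" "\<And>x. \<bar>V x\<bar> \<le> N"
    using VC bounded_range_abs_obtain unfolding bounded_C_def by blast
  obtain K where K: "K \<ge> 0" "\<And>x. \<bar>r' x\<bar> \<le> K"
    using C'(3) bounded_range_abs_obtain unfolding bounded_C_def by blast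
  \<comment> \<open>Large enough to bound \<open>V\<close> and to give an invariant ball. Since the
    quadratic coefficient is 0, enlarging the radius does not affect smallness.\<close>
  define M' where "M' = N + K / (1 - q)"
  have M': "M' \<ge> N" "q * M' + K \<le> M'"
  proof -
    show "M' \<ge> N"
      using K q by (simp add: M'_def)
    have "(1 - q) * M' = (1 - q) * N + K"
      using q by (simp add: M'_def distrib_left)
    then have "M' - (q * M' + K) = (1 - q) * N"
      by (simp add: left_diff_distrib)
    also have "\<dots> \<ge> 0"
      using q N by simp
    finally show "q * M' + K \<le> M'"
      by simp
  qed
  have "bounded_derivs k V"
  proof (rule Suc.IH[of V a' b' "\<lambda>_. 0" r' M', OF q A])
    show "V x = a' x * V (F x) + b' x * V (G x) + 0 * (V (F x) * V (G x)) + r' x" for x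
      by (subst V) (simp add: a'_def b'_def r'_def)
    show "\<bar>V x\<bar> \<le> M'" for x
      using N(2)[of x] M'(1) by simp
    have s': "(\<bar>a' x\<bar> + \<bar>b' x\<bar>) * A ^ k \<le> q" for x
    proof -
      have "(\<bar>a' x\<bar> + \<bar>b' x\<bar>) * A ^ k \<le> (\<bar>a x\<bar> + \<bar>b x\<bar> + 2 * M * \<bar>c x\<bar>) * A * A ^ k"
        using A by (intro mult_right_mono coeff') auto
      then show ?thesis
        using small[of x] by (simp add: mult.assoc)
    qed
    then show "(\<bar>a' x\<bar> + \<bar>b' x\<bar> + 2 * M' * \<bar>0\<bar>) * A ^ k \<le> q" for x
      by simp
    have "\<bar>a' x\<bar> + \<bar>b' x\<bar> \<le> q" for x
      using s'[of x] mult_left_mono[OF one_le_power[OF A, of k], of "\<bar>a' x\<bar> + \<bar>b' x\<bar>"] by simp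
    then have coeff_M': "(\<bar>a' x\<bar> + \<bar>b' x\<bar>) * M' \<le> q * M'" for x
      using M' N by (intro mult_right_mono) auto
    show "\<bar>a' x\<bar> * M' + \<bar>b' x\<bar> * M' + \<bar>0\<bar> * (M' * M') + \<bar>r' x\<bar> \<le> M'" for x
      using K(2)[of x] M'(2) coeff_M'[of x] unfolding distrib_right by simp
    show "continuous_on UNIV V"
      using VC by (simp add: bounded_C_def bounded_derivs_0)
  qed (rule C' low F(2) G(2) bounded_C_const)+
  moreover have "bounded (range V)"
    using VC by (simp add: bounded_C_def)
  ultimately have "bounded_C k V"
    by (simp add: bounded_C_def)
  with Vder show ?case
    by (rule bounded_derivs_SucI)
qed

subsection \<open>The nonlinear equation\<close>

text \<open>The conditions in \<open>small\<close> respectively make the fixed point operator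
  contract, preserve the bound \<open>L\<close> on Lipschitz constants and derivatives, and make the
  differentiated equation contract.\<close>

lemma C1_solution_of_functional_equation:
  fixes H F g :: "real \<Rightarrow> real"
  assumes q: "q < 1" and L: "0 \<le> L" and \<mu>: "0 \<le> \<mu>" and A: "0 \<le> A"
    and H: "bounded_derivs (Suc 0) H" "\<And>x. \<bar>deriv H x\<bar> \<le> \<mu>"
    and F: "bounded_derivs (Suc 0) F" "\<And>x. \<bar>deriv F x\<bar> \<le> A"
    and g: "bounded_C (Suc 0) g" "\<And>x. \<bar>deriv g x\<bar> \<le> \<beta>"
    and small: "\<mu> * (1 + L) \<le> q" "\<mu> * A * (L * L + \<beta>) \<le> L" "\<mu> * A * (2 * L) \<le> q"
  obtains \<phi> where "\<And>x. \<phi> x = H (\<phi> (\<phi> (F x)) - g (F x))"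
    "bounded (range \<phi>)" "bounded_derivs (Suc 0) \<phi>" "\<And>x. \<bar>deriv \<phi> x\<bar> \<le> L"
proof -
  have q0: "0 \<le> q"
    using small(1) \<mu> L by (smt (verit) mult_nonneg_nonneg)
  have "\<mu> \<le> q"
    using small(1) mult_left_mono[of 1 "1 + L" \<mu>] \<mu> L by simp
  then have \<mu>1: "\<mu> < 1"
    using q by simp
  have \<beta>: "0 \<le> \<beta>"
    using g(2)[of 0] by simp
  note der = bounded_derivs_SucD(1)[OF H(1)] bounded_derivs_SucD(1)[OF F(1)] bounded_C_SucD(1)[OF g(1)]
  have H_lip: "\<bar>H x - H y\<bar> \<le> \<mu> * \<bar>x - y\<bar>" for x y
    using abs_diff_le_of_DERIV_bound der(1) H(2) by blast
  have F_lip: "\<bar>F x - F y\<bar> \<le> A * \<bar>x - y\<bar>" for x y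
    using abs_diff_le_of_DERIV_bound der(2) F(2) by blast
  have g_lip: "\<bar>g x - g y\<bar> \<le> \<beta> * \<bar>x - y\<bar>" for x y
    using abs_diff_le_of_DERIV_bound der(3) g(2) by blast
  have cont: "continuous_on UNIV (deriv H)" "continuous_on UNIV (deriv F)" "continuous_on UNIV (deriv g)"
    "continuous_on UNIV F" "continuous_on UNIV g"
    using bounded_derivs_SucD(2)[OF H(1)] bounded_derivs_SucD(2)[OF F(1)] bounded_C_SucD(2)[OF g(1)]
      bounded_derivs_continuous[OF F(1)] bounded_derivs_continuous[of "Suc 0" g] g(1)
    unfolding bounded_C_def bounded_derivs_0 by blast+
  obtain B where B: "0 \<le> B" "\<And>x. \<bar>g x\<bar> \<le> B"
    using g(1) bounded_range_abs_obtain unfolding bounded_C_def by blast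
  \<comment> \<open>Solves \<open>\<bar>H 0\<bar> + \<mu> * (R + B) = R\<close>, so that
    \<open>T\<close> preserves the bound \<open>R\<close>.\<close>
  define R where "R = (\<bar>H 0\<bar> + \<mu> * B) / (1 - \<mu>)"
  have R0: "0 \<le> R"
    using \<mu> \<mu>1 B by (simp add: R_def)
  have "(1 - \<mu>) * R = \<bar>H 0\<bar> + \<mu> * B"
    using \<mu>1 by (simp add: R_def)
  then have R: "\<bar>H 0\<bar> + \<mu> * (R + B) = R"
    by (simp add: algebra_simps)
  define T where "T \<phi> x = H (\<phi> (\<phi> (F x)) - g (F x))" for \<phi> :: "real \<Rightarrow> real" and x
  define P where "P \<phi> \<longleftrightarrow> (\<forall>x. \<bar>\<phi> x\<bar> \<le> R) \<and> (\<forall>x y. \<bar>\<phi> x - \<phi> y\<bar> \<le> L * \<bar>x - y\<bar>)" for \<phi> :: "real \<Rightarrow> real"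
  have PD: "\<bar>\<phi> x\<bar> \<le> R" "\<bar>\<phi> x - \<phi> y\<bar> \<le> L * \<bar>x - y\<bar>" if "P \<phi>" for \<phi> x y
    using that by (auto simp: P_def)
  have P0: "P (\<lambda>_. 0)"
    using R0 L by (simp add: P_def)
  have arg: "\<bar>\<phi> z - g y\<bar> \<le> R + B" if "P \<phi>" for \<phi> y z
    using PD(1)[OF that, of z] B(2)[of y] by linarith
  have PT: "P (T \<phi>)" if \<phi>: "P \<phi>" for \<phi>
  proof -
    have "\<bar>T \<phi> x\<bar> \<le> R" for x
    proof -
      have "\<bar>T \<phi> x\<bar> \<le> \<bar>H 0\<bar> + \<mu> * \<bar>\<phi> (\<phi> (F x)) - g (F x)\<bar>"
        using H_lip[of "\<phi> (\<phi> (F x)) - g (F x)" 0] by (simp add: T_def)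
      also have "\<dots> \<le> \<bar>H 0\<bar> + \<mu> * (R + B)"
        by (intro add_left_mono mult_left_mono arg \<phi> \<mu>)
      finally show ?thesis
        using R by simp
    qed
    moreover have "\<bar>T \<phi> x - T \<phi> y\<bar> \<le> L * \<bar>x - y\<bar>" for x y
    proof -
      have "\<bar>\<phi> (\<phi> (F x)) - \<phi> (\<phi> (F y))\<bar> \<le> L * (L * \<bar>F x - F y\<bar>)"
        by (rule order_trans[OF PD(2)[OF \<phi>] mult_left_mono[OF PD(2)[OF \<phi>] L]])
      moreover have "\<bar>g (F x) - g (F y)\<bar> \<le> \<beta> * \<bar>F x - F y\<bar>"
        by (rule g_lip)
      ultimately have "\<bar>(\<phi> (\<phi> (F x)) - g (F x)) - (\<phi> (\<phi> (F y)) - g (F y))\<bar> \<le> (L * L + \<beta>) * \<bar>F x - F y\<bar>"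
        by (simp add: distrib_right)
      also have "\<dots> \<le> (L * L + \<beta>) * (A * \<bar>x - y\<bar>)"
        using L \<beta> by (intro mult_left_mono F_lip) auto
      finally have "\<bar>T \<phi> x - T \<phi> y\<bar> \<le> \<mu> * ((L * L + \<beta>) * (A * \<bar>x - y\<bar>))"
        unfolding T_def using order_trans[OF H_lip mult_left_mono[OF _ \<mu>]] by blast
      also have "\<dots> = \<mu> * A * (L * L + \<beta>) * \<bar>x - y\<bar>"
        by simp
      also have "\<dots> \<le> L * \<bar>x - y\<bar>"
        by (rule mult_right_mono[OF small(2)]) simp
      finally show ?thesis .
    qed
    ultimately show ?thesis
      by (simp add: P_def)
  qed
  \<comment> \<open>The intermediate value \<open>\<phi> (\<psi> y)\<close> separates the inner
    error, multiplied by \<open>L\<close>, from the outer one.\<close>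
  have comp_diff: "\<bar>\<phi> (\<phi> y) - \<psi> (\<psi> y)\<bar> \<le> (1 + L) * e"
    if "P \<phi>" "\<And>x. \<bar>\<phi> x - \<psi> x\<bar> \<le> e" for \<phi> \<psi> :: "real \<Rightarrow> real" and e y
  proof -
    have "\<bar>\<phi> (\<phi> y) - \<phi> (\<psi> y)\<bar> \<le> L * e"
      by (rule order_trans[OF PD(2)[OF that(1)] mult_left_mono[OF that(2) L]])
    then show ?thesis
      using that(2)[of "\<psi> y"] by (simp add: distrib_right)
  qed
  have Tcontr: "\<bar>T \<phi> x - T \<psi> x\<bar> \<le> q * e"
    if "P \<phi>" "\<And>x. \<bar>\<phi> x - \<psi> x\<bar> \<le> e" for \<phi> \<psi> e x
  proof -
    have e: "0 \<le> e"
      using that(2)[of 0] by simp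
    have "\<bar>T \<phi> x - T \<psi> x\<bar> \<le> \<mu> * \<bar>\<phi> (\<phi> (F x)) - \<psi> (\<psi> (F x))\<bar>"
      using H_lip[of "\<phi> (\<phi> (F x)) - g (F x)" "\<psi> (\<psi> (F x)) - g (F x)"] by (simp add: T_def)
    also have "\<dots> \<le> \<mu> * ((1 + L) * e)"
      by (rule mult_left_mono[OF comp_diff[OF that] \<mu>])
    also have "\<dots> \<le> q * e"
      using mult_right_mono[OF small(1) e] by simp
    finally show ?thesis .
  qed
  have Pclosed: "P \<psi>" if w: "\<And>i. P (w i)" "uniform_limit UNIV w \<psi> sequentially" for w \<psi>
  proof -
    have lim: "(\<lambda>i. w i x) \<longlonglongrightarrow> \<psi> x" for x
      using tendsto_uniform_limitI[OF w(2)] by simp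
    have "\<bar>\<psi> x\<bar> \<le> R" for x
      by (rule LIMSEQ_le_const2[OF tendsto_rabs[OF lim]]) (use PD(1)[OF w(1)] in auto)
    moreover have "\<bar>\<psi> x - \<psi> y\<bar> \<le> L * \<bar>x - y\<bar>" for x y
      by (rule LIMSEQ_le_const2[OF tendsto_rabs[OF tendsto_diff[OF lim lim]]]) (use PD(2)[OF w(1)] in auto)
    ultimately show ?thesis
      by (simp add: P_def)
  qed
  have "\<exists>\<phi>. P \<phi> \<and> T \<phi> = \<phi>"
  proof (rule contraction_fixpoint[where T = T and P = P and M = R, OF q0 q])
    show "\<bar>T v x - T w x\<bar> \<le> q * e" if "P v" "\<And>x. \<bar>v x - w x\<bar> \<le> e" for v w e x
      using Tcontr that by blast
  qed (fact PD(1) Pclosed PT P0)+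
  then obtain \<phi> where \<phi>: "P \<phi>" "T \<phi> = \<phi>"
    by blast

  \<comment> \<open>The derivative of \<open>T \<psi>\<close>, with \<open>v\<close> in place of the
    derivative of \<open>\<psi>\<close>.\<close>
  define S where "S \<psi> v x = deriv H (\<psi> (\<psi> (F x)) - g (F x)) * (v (\<psi> (F x)) * v (F x) - deriv g (F x)) * deriv F x"
    for \<psi> v x
  define u where "u j = (T ^^ j) (\<lambda>_. 0)" for j
  define v where "v = rec_nat (\<lambda>_. 0) (\<lambda>j. S (u j))"
  have u_Suc: "u (Suc j) = T (u j)" for j
    by (simp add: u_def)
  have v_Suc: "v (Suc j) = S (u j) (v j)" for j
    by (simp add: v_def)
  have u0: "u 0 = (\<lambda>_. 0)" and v0: "v 0 = (\<lambda>_. 0)"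
    by (auto simp: u_def v_def)
  have Pu: "P (u j)" for j
    by (induction j) (simp_all add: u0 P0 u_Suc PT)
  have u_lim: "uniform_limit UNIV u \<phi> sequentially"
  proof (rule fiber_contraction[where T = "\<lambda>_. T" and P = P and M = R, OF q0 q])
    show "\<bar>T v x - T w x\<bar> \<le> q * e" if "P v" "\<And>x. \<bar>v x - w x\<bar> \<le> e" for v w e x
      using Tcontr that by blast
    show "uniform_limit UNIV (\<lambda>_. T \<phi>) \<phi> sequentially"
      unfolding \<phi>(2) by (rule uniform_limit_const)
  qed (fact PD(1) PT \<phi>(1) Pu u_Suc)+
  have u_der: "(u j has_field_derivative v j x) (at x)" for j x
  proof (induction j arbitrary: x)
    case 0
    show ?case
      by (simp add: u0 v0)
  next
    case (Suc j)
    have "((\<lambda>x. u j (u j (F x)) - g (F x)) has_field_derivative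
        v j (u j (F x)) * (v j (F x) * deriv F x) - deriv g (F x) * deriv F x) (at x)"
      by (intro DERIV_diff DERIV_chain2[OF Suc.IH] DERIV_chain2[OF der(3)] der(2))
    from DERIV_chain2[OF der(1) this]
    show ?case
      unfolding u_Suc v_Suc T_def[abs_def] S_def by (rule DERIV_cong) (simp add: algebra_simps)
  qed
  have P_cont: "continuous_on UNIV \<psi>" if "P \<psi>" for \<psi>
    by (rule lipschitz_on_continuous_on[of L])
      (use PD(2)[OF that] L in \<open>auto intro!: lipschitz_onI simp: dist_real_def\<close>)
  \<comment> \<open>Continuity is part of the invariant because the fixed point \<open>V\<close>
    will be evaluated at the moving points \<open>u j (F x)\<close>.\<close>
  define PV where "PV w \<longleftrightarrow> (\<forall>x. \<bar>w x\<bar> \<le> L) \<and> continuous_on UNIV w" for w :: "real \<Rightarrow> real"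
  have PVD: "\<bar>w x\<bar> \<le> L" "continuous_on UNIV w" if "PV w" for w x
    using that by (auto simp: PV_def)
  have PV0: "PV (\<lambda>_. 0)"
    using L by (simp add: PV_def)
  have PVS: "PV (S \<psi> w)" if \<psi>: "P \<psi>" and w: "PV w" for \<psi> w
  proof -
    have "\<bar>S \<psi> w x\<bar> \<le> L" for x
    proof -
      have "\<bar>w (\<psi> (F x)) * w (F x)\<bar> \<le> L * L"
        unfolding abs_mult by (intro mult_mono PVD(1) w L) simp
      then have "\<bar>w (\<psi> (F x)) * w (F x) - deriv g (F x)\<bar> \<le> L * L + \<beta>"
        using g(2)[of "F x"] by linarith
      then have "\<bar>S \<psi> w x\<bar> \<le> \<mu> * (L * L + \<beta>) * A"
        unfolding S_def abs_mult using \<mu> L \<beta> by (intro mult_mono H F) auto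
      then show ?thesis
        using small(2) by (simp add: ac_simps)
    qed
    moreover have "continuous_on UNIV (S \<psi> w)"
    proof -
      note comp = continuous_on_compose2[OF _ _ subset_UNIV]
      show ?thesis
        unfolding S_def[abs_def]
        by (intro continuous_on_mult continuous_on_diff comp[OF cont(1)] comp[OF P_cont[OF \<psi>]] comp[OF cont(3)]
            comp[OF cont(5)] comp[OF PVD(2)[OF w]] cont(2,4))
    qed
    ultimately show ?thesis
      by (simp add: PV_def)
  qed
  \<comment> \<open>The rate is the same for all \<open>\<psi>\<close>, as fiber contraction
    demands; \<open>2 * L\<close> comes from the quadratic term on the ball of radius
    \<open>L\<close>.\<close>
  have Scontr: "\<bar>S \<psi> w x - S \<psi> z x\<bar> \<le> q * e"
    if w: "PV w" "PV z" "\<And>x. \<bar>w x - z x\<bar> \<le> e" for \<psi> w z e x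
  proof -
    have e: "0 \<le> e"
      using w(3)[of 0] by simp
    define y where "y = \<psi> (F x)"
    have "S \<psi> w x - S \<psi> z x = deriv H (\<psi> (\<psi> (F x)) - g (F x)) * (w y * w (F x) - z y * z (F x)) * deriv F x"
      by (simp add: S_def y_def algebra_simps)
    then have "\<bar>S \<psi> w x - S \<psi> z x\<bar> = \<bar>deriv H (\<psi> (\<psi> (F x)) - g (F x))\<bar> * \<bar>w y * w (F x) - z y * z (F x)\<bar> * \<bar>deriv F x\<bar>"
      by (simp add: abs_mult)
    also have "\<dots> \<le> \<mu> * (2 * L * e) * A"
      using \<mu> L e by (intro mult_mono H F abs_mult_diff_le PVD(1) w) auto
    also have "\<dots> = \<mu> * A * (2 * L) * e"
      by simp
    also have "\<dots> \<le> q * e"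
      by (rule mult_right_mono[OF small(3) e])
    finally show ?thesis .
  qed
  have PVclosed: "PV z" if w: "\<And>i. PV (w i)" "uniform_limit UNIV w z sequentially" for w z
  proof -
    have "\<bar>z x\<bar> \<le> L" for x
      by (rule LIMSEQ_le_const2[OF tendsto_rabs[OF tendsto_uniform_limitI[OF w(2)]]]) (use PVD(1)[OF w(1)] in auto)
    moreover have "continuous_on UNIV z"
      by (rule uniform_limit_theorem[OF _ w(2)]) (use PVD(2)[OF w(1)] in auto)
    ultimately show ?thesis
      by (simp add: PV_def)
  qed
  have "\<exists>V. PV V \<and> S \<phi> V = V"
    by (rule contraction_fixpoint[where T = "S \<phi>" and P = PV and M = L, OF q0 q])
      (fact PVD(1) PVclosed PVS[OF \<phi>(1)] Scontr PV0)+
  then obtain V where V: "PV V" "S \<phi> V = V"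
    by blast
  \<comment> \<open>\<open>deriv H\<close> and \<open>V\<close> are merely continuous on the line.
    Their arguments stay in the balls of radius \<open>R + B\<close> and \<open>R\<close>, where
    they are uniformly continuous.\<close>
  have uc: "uniformly_continuous_on (cball 0 K) w" if "continuous_on UNIV w" for w :: "real \<Rightarrow> real" and K
    using that continuous_on_subset by (intro compact_uniformly_continuous) auto
  have "uniform_limit UNIV (\<lambda>j x. u j (u j (F x))) (\<lambda>x. \<phi> (\<phi> (F x))) sequentially"
  proof (rule uniform_limitI)
    fix e :: real
    assume e: "e > 0"
    \<comment> \<open>Makes the bound from \<open>comp_diff\<close> equal to
      \<open>e / 2\<close>.\<close>
    define d where "d = e / (2 * (1 + L))"
    have d: "d > 0" "(1 + L) * d < e"
      using e L by (simp_all add: d_def pos_divide_less_eq mult.commute)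
    show "\<forall>\<^sub>F j in sequentially. \<forall>x\<in>UNIV. dist (u j (u j (F x))) (\<phi> (\<phi> (F x))) < e"
      using uniform_limitD[OF u_lim d(1)]
    proof eventually_elim
      case (elim j)
      then have "\<bar>u j x - \<phi> x\<bar> \<le> d" for x
        by (auto simp: dist_real_def less_imp_le)
      from comp_diff[OF Pu this] d(2) show ?case
        by (fastforce simp: dist_real_def intro: le_less_trans)
    qed
  qed
  then have "uniform_limit UNIV (\<lambda>j x. u j (u j (F x)) - g (F x)) (\<lambda>x. \<phi> (\<phi> (F x)) - g (F x)) sequentially"
    by (intro uniform_limit_minus uniform_limit_const)
  then have H_lim: "uniform_limit UNIV (\<lambda>j x. deriv H (u j (u j (F x)) - g (F x)))
      (\<lambda>x. deriv H (\<phi> (\<phi> (F x)) - g (F x))) sequentially"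
    by (rule uniform_limit_compose_uniformly_continuous_on[OF _ uc[OF cont(1), of "R + B"]])
      (use arg[OF Pu] in \<open>simp_all add: mem_cball_0 del: mem_cball\<close>)
  have "uniform_limit UNIV (\<lambda>j x. u j (F x)) (\<lambda>x. \<phi> (F x)) sequentially"
    using uniform_limit_compose'[OF u_lim] by auto
  then have V_lim: "uniform_limit UNIV (\<lambda>j x. V (u j (F x))) (\<lambda>x. V (\<phi> (F x))) sequentially"
    by (rule uniform_limit_compose_uniformly_continuous_on[OF _ uc[OF PVD(2)[OF V(1)], of R]])
      (use PD(1)[OF Pu] in simp_all)
  have bdd: "bounded (range (deriv H))" "bounded (range (deriv F))" "bounded (range (deriv g))" "bounded (range V)"
    unfolding bounded_range_iff_abs using H(2) F(2) g(2) PVD(1)[OF V(1)] by blast+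
  have v_lim: "uniform_limit UNIV v V sequentially"
  proof (rule fiber_contraction[where T = "\<lambda>j. S (u j)" and P = PV and M = L, OF q0 q])
    have "uniform_limit UNIV (\<lambda>j. S (u j) V) (S \<phi> V) sequentially"
      unfolding S_def[abs_def]
      by (intro uniform_lim_mult uniform_limit_minus H_lim V_lim uniform_limit_const
          bounded_range_mult bounded_minus_comp bounded_range_comp[OF bdd(1)] bounded_range_comp[OF bdd(3)]
          bounded_range_comp[OF bdd(4)] bdd(2))
    then show "uniform_limit UNIV (\<lambda>j. S (u j) V) V sequentially"
      unfolding V(2) .
    show "PV (v 0)"
      using PV0 by (simp add: v0)
  qed (fact PVD(1) PVS[OF Pu] Scontr V(1) v_Suc)+
  have \<phi>_der: "(\<phi> has_field_derivative V x) (at x)" for x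
    using DERIV_uniform_limit[OF u_der _ v_lim] tendsto_uniform_limitI[OF u_lim] by blast
  then have "deriv \<phi> x = V x" for x
    using DERIV_imp_deriv by blast
  then have "\<bar>deriv \<phi> x\<bar> \<le> L" for x
    using PVD(1)[OF V(1)] by simp
  moreover have "bounded_C 0 V"
    using V(1) bdd(4) by (simp add: bounded_C_def bounded_derivs_0 PV_def)
  then have "bounded_derivs (Suc 0) \<phi>"
    using \<phi>_der bounded_derivs_SucI by blast
  moreover have "bounded (range \<phi>)"
    using PD(1)[OF \<phi>(1)] bounded_range_iff_abs by blast
  moreover have "\<phi> x = H (\<phi> (\<phi> (F x)) - g (F x))" for x
    using fun_cong[OF \<phi>(2), of x] by (simp add: T_def)
  ultimately show ?thesis
    using that by blast
qed

text \<open>\<open>deriv \<phi>\<close> solves a quadratic equation with \<open>a = b = 0\<close>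
  whose other coefficients contain \<open>\<phi>\<close> undifferentiated. Order \<open>k\<close> of
  \<open>\<phi>\<close> thus gives order \<open>k\<close> of \<open>deriv \<phi>\<close>.\<close>

lemma solution_regularity:
  fixes \<phi> H F g :: "real \<Rightarrow> real"
  assumes A: "1 \<le> A" and L: "0 \<le> L" "L \<le> 1" and small: "2 * L * A * A ^ n \<le> q" "q < 1" "A * (L * L + \<beta>) \<le> L"
    and H: "bounded_derivs n H" "\<And>x. \<bar>deriv H x\<bar> \<le> 1"
    and F: "bounded_derivs n F" "\<And>x. \<bar>deriv F x\<bar> \<le> A"
    and g: "bounded_C n g" "\<And>x. \<bar>deriv g x\<bar> \<le> \<beta>"
    and eq: "\<And>x. \<phi> x = H (\<phi> (\<phi> (F x)) - g (F x))"
    and \<phi>: "bounded_derivs (Suc 0) \<phi>" "\<And>x. \<bar>deriv \<phi> x\<bar> \<le> L"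
    and k: "1 \<le> k" "k \<le> n"
  shows "bounded_derivs k \<phi>"
  using k
proof (induction k rule: nat_induct_at_least)
  case base
  show ?case
    using \<phi>(1) by simp
next
  case (Suc k)
  \<comment> \<open>The derivatives of \<open>H\<close>, \<open>F\<close> and \<open>g\<close> have
    order \<open>n - 1\<close>, which still covers \<open>k\<close>.\<close>
  have "n = Suc (n - 1)" "k \<le> n - 1"
    using Suc by simp_all
  then obtain n' where n': "n = Suc n'" "k \<le> n'"
    by blast
  note H' = H(1)[unfolded n'(1)] and F' = F(1)[unfolded n'(1)] and g' = g(1)[unfolded n'(1)]
  have dH: "bounded_C k (deriv H)" and dF: "bounded_C k (deriv F)" and dg: "bounded_C k (deriv g)"
    using bounded_C_mono[OF _ n'(2)] bounded_derivs_SucD(2)[OF H'] bounded_derivs_SucD(2)[OF F'] bounded_C_SucD(2)[OF g']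
    by blast+
  have Fk: "bounded_derivs k F" and gk: "bounded_derivs k g"
    using bounded_derivs_mono[OF _ Suc_leD[OF Suc.prems]] F(1) g(1) unfolding bounded_C_def by blast+
  have \<phi>k: "bounded_derivs k \<phi>"
    using Suc by simp
  define G where "G x = \<phi> (F x)" for x
  define c where "c x = deriv H (\<phi> (\<phi> (F x)) - g (F x)) * deriv F x" for x
  define r where "r x = - (c x * deriv g (F x))" for x
  note der = bounded_derivs_SucD(1)[OF H'] bounded_derivs_SucD(1)[OF F'] bounded_C_SucD(1)[OF g'] bounded_derivs_SucD(1)[OF \<phi>(1)]
  have Gk: "bounded_derivs k G"
    unfolding G_def[abs_def] by (rule bounded_derivs_comp[OF \<phi>k Fk])
  have "bounded_derivs k (\<lambda>x. \<phi> (\<phi> (F x)) - g (F x))"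
  proof -
    have "bounded_C k (\<lambda>x. - g (F x))"
      using bounded_C_minus[OF bounded_C_comp[OF _ Fk]] gk g(1) unfolding bounded_C_def by blast
    then have "bounded_derivs k (\<lambda>x. \<phi> (G x) + - g (F x))"
      using bounded_derivs_add[OF bounded_derivs_comp[OF \<phi>k Gk]] unfolding bounded_C_def by blast
    then show ?thesis
      by (simp add: G_def)
  qed
  then have ck: "bounded_C k c"
    unfolding c_def[abs_def] by (intro bounded_C_mult bounded_C_comp[OF dH] dF)
  then have rk: "bounded_C k r"
    unfolding r_def[abs_def] by (intro bounded_C_minus bounded_C_mult bounded_C_comp[OF dg] Fk)
  have G_der: "(G has_field_derivative deriv \<phi> (F x) * deriv F x) (at x)" for x
    unfolding G_def[abs_def] by (intro DERIV_chain2[OF der(4)] der(2))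
  \<comment> \<open>As \<open>L\<close> is at most 1, \<open>G\<close> inherits the derivative bound
    of \<open>F\<close>.\<close>
  have G_le: "\<bar>deriv G x\<bar> \<le> A" for x
  proof -
    have "\<bar>deriv G x\<bar> = \<bar>deriv \<phi> (F x)\<bar> * \<bar>deriv F x\<bar>"
      by (simp add: DERIV_imp_deriv[OF G_der] abs_mult)
    also have "\<dots> \<le> 1 * A"
      using order_trans[OF \<phi>(2) L(2)] by (intro mult_mono F) auto
    finally show ?thesis
      by simp
  qed
  have c_le: "\<bar>c x\<bar> \<le> A" for x
    using mult_mono[OF H(2) F(2)[of x]] by (simp add: c_def abs_mult)
  have \<phi>_eq: "deriv \<phi> x = 0 * deriv \<phi> (F x) + 0 * deriv \<phi> (G x) + c x * (deriv \<phi> (F x) * deriv \<phi> (G x)) + r x" for x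
  proof -
    have "((\<lambda>x. H (\<phi> (G x) - g (F x))) has_field_derivative
        deriv H (\<phi> (G x) - g (F x)) * (deriv \<phi> (G x) * (deriv \<phi> (F x) * deriv F x) - deriv g (F x) * deriv F x)) (at x)"
      by (intro DERIV_chain2[OF der(1)] DERIV_diff DERIV_chain2[OF der(4)] DERIV_chain2[OF der(3)] G_der der(2))
    moreover have "(\<lambda>x. H (\<phi> (G x) - g (F x))) = \<phi>"
      unfolding G_def by (rule ext, rule eq[symmetric])
    ultimately have "deriv \<phi> x = deriv H (\<phi> (G x) - g (F x))
        * (deriv \<phi> (G x) * (deriv \<phi> (F x) * deriv F x) - deriv g (F x) * deriv F x)"
      using DERIV_imp_deriv by metis
    then show ?thesis
      by (simp add: c_def r_def G_def algebra_simps)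
  qed
  have "bounded_derivs k (deriv \<phi>)"
  proof (rule quadratic_equation_regularity[OF small(2) A _ \<phi>_eq \<phi>(2)])
    show "continuous_on UNIV (deriv \<phi>)"
      using bounded_derivs_SucD(2)[OF \<phi>(1)] by (simp add: bounded_C_def bounded_derivs_0)
    \<comment> \<open>\<open>r\<close> carries the factor \<open>c\<close>, so invariance of the
      ball of radius \<open>L\<close> reduces to the third condition in
      \<open>small\<close>.\<close>
    show "\<bar>0\<bar> * L + \<bar>0\<bar> * L + \<bar>c x\<bar> * (L * L) + \<bar>r x\<bar> \<le> L" for x
    proof -
      have "\<bar>c x\<bar> * (L * L) + \<bar>r x\<bar> = \<bar>c x\<bar> * (L * L + \<bar>deriv g (F x)\<bar>)"
        by (simp add: r_def abs_mult distrib_left)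
      also have "\<dots> \<le> A * (L * L + \<beta>)"
        using A L by (intro mult_mono add_left_mono c_le g) auto
      finally show ?thesis
        using small(3) by simp
    qed
    show "(\<bar>0\<bar> + \<bar>0\<bar> + 2 * L * \<bar>c x\<bar>) * A ^ k \<le> q" for x
    proof -
      \<comment> \<open>Enlarging \<open>A ^ k\<close> to \<open>A ^ n\<close> gives one smallness
        condition for all orders.\<close>
      have "2 * L * \<bar>c x\<bar> * A ^ k \<le> 2 * L * A * A ^ n"
        using A L Suc.prems by (intro mult_mono power_increasing c_le) auto
      then show ?thesis
        using small(1) by simp
    qed
  qed (rule bounded_C_const ck rk Fk F(2) Gk G_le)+
  moreover have "bounded (range (deriv \<phi>))"
    using \<phi>(2) bounded_range_iff_abs by blast
  ultimately have "bounded_C k (deriv \<phi>)"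
    by (simp add: bounded_C_def)
  with der(4) show ?case
    by (rule bounded_derivs_SucI)
qed


section \<open>Choice of the constants and return to the original equation\<close>

theorem theorem1:
  fixes n :: nat and m \<alpha> :: real
  assumes "n \<ge> 1" and "m > 1" and "\<alpha> > 0"
  shows "\<exists>\<beta>\<^sub>0>0. \<forall>\<beta>::real. 0 < \<beta> \<and> \<beta> \<le> \<beta>\<^sub>0 \<longrightarrow>
    (\<forall>h f g :: real \<Rightarrow> real.
       C_class n h \<and> C_class n f \<and> C_class n g \<and>
       (\<forall>x. \<bar>deriv h x\<bar> \<ge> m) \<and>
       (\<forall>x. \<bar>deriv f x\<bar> \<ge> \<alpha>) \<and>
       (\<forall>k\<in>{1..n}. \<forall>x. \<bar>(deriv ^^ k) g x\<bar> \<le> \<beta>) \<and>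
       bounded (range g) \<and>
       (\<forall>k\<in>{1..n}. bounded (range ((deriv ^^ k) h)) \<and> bounded (range ((deriv ^^ k) f))) \<longrightarrow>
       (\<exists>\<phi> :: real \<Rightarrow> real.
          C_class n \<phi> \<and> bounded (range \<phi>) \<and>
          (\<forall>k\<in>{1..n}. bounded (range ((deriv ^^ k) \<phi>))) \<and>
          (\<forall>x. \<phi> (\<phi> x) = h (\<phi> (f x)) + g x)))"
proof -
  define A where "A = max 1 (1 / \<alpha>)"
  \<comment> \<open>The first entry yields \<open>(1 + L) / m < 1\<close>, the second keeps
    \<open>L * A ^ i\<close> at most 1/4 for all powers that occur.\<close>
  define L where "L = min ((m - 1) / 2) (1 / (4 * A ^ (n + 2)))"
  \<comment> \<open>The entry 1/2 covers \<open>2 * L * A\<close> and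
    \<open>2 * L * A * A ^ n\<close>; the other is the contraction rate of the fixed point
    operator.\<close>
  define q where "q = max (1 / 2) ((1 + L) / m)"
  have A: "1 \<le> A" "1 / \<alpha> \<le> A"
    by (auto simp: A_def)
  have L: "0 < L" "L \<le> (m - 1) / 2" "L \<le> 1 / (4 * A ^ (n + 2))"
    unfolding L_def by (use assms A in simp, rule min.cobounded1, rule min.cobounded2)
  have LA: "L * A ^ i \<le> 1 / 4" if "i \<le> n + 2" for i
  proof -
    have "L * A ^ i \<le> L * A ^ (n + 2)"
      using that A L by (intro mult_left_mono power_increasing) auto
    also have "\<dots> \<le> 1 / (4 * A ^ (n + 2)) * A ^ (n + 2)"
      using L(3) A by (intro mult_right_mono) auto
    also have "\<dots> = 1 / 4"
      using A by simp
    finally show ?thesis .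
  qed
  have LA0: "L \<le> 1 / 4" and LA1: "L * A \<le> 1 / 4" and LAn: "L * A * A ^ n \<le> 1 / 4"
    using LA[of 0] LA[of 1] LA[of "Suc n"] by (simp_all add: mult.assoc)
  have q: "q < 1" "1 / 2 \<le> q" "1 / m * (1 + L) \<le> q"
    using assms L(2) by (auto simp: q_def field_simps)
  \<comment> \<open>\<open>A * \<beta>\<close> stays below \<open>L / 2\<close>, and
    \<open>A * L * L\<close> below \<open>L / 4\<close>, which gives the invariance condition
    \<open>ball\<close>.\<close>
  define \<beta>0 where "\<beta>0 = L / (2 * A)"
  have \<beta>0: "\<beta>0 > 0" "A * \<beta>0 = L / 2"
    using L A by (auto simp: \<beta>0_def)
  show ?thesis
  proof (intro exI[of _ \<beta>0] conjI allI impI \<beta>0(1))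
    fix \<beta> :: real and h f g :: "real \<Rightarrow> real"
    assume \<beta>: "0 < \<beta> \<and> \<beta> \<le> \<beta>0"
    assume "C_class n h \<and> C_class n f \<and> C_class n g \<and>
       (\<forall>x. \<bar>deriv h x\<bar> \<ge> m) \<and>
       (\<forall>x. \<bar>deriv f x\<bar> \<ge> \<alpha>) \<and>
       (\<forall>k\<in>{1..n}. \<forall>x. \<bar>(deriv ^^ k) g x\<bar> \<le> \<beta>) \<and>
       bounded (range g) \<and>
       (\<forall>k\<in>{1..n}. bounded (range ((deriv ^^ k) h)) \<and> bounded (range ((deriv ^^ k) f)))"
    then have hf: "bounded_derivs n h" "bounded_derivs n f"
      and m_le_h: "\<And>x. m \<le> \<bar>deriv h x\<bar>" and \<alpha>_le_f: "\<And>x. \<alpha> \<le> \<bar>deriv f x\<bar>"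
      and gC: "C_class n g" "bounded (range g)" and g_le: "\<forall>k\<in>{1..n}. \<forall>x. \<bar>(deriv ^^ k) g x\<bar> \<le> \<beta>"
      by (simp_all add: bounded_derivs_def ball_conj_distrib)
    have m0: "m > 0"
      using assms(2) by simp
    obtain H where H: "\<And>x. h (H x) = x" "\<And>x. H (h x) = x" "bounded_derivs n H" "\<And>x. \<bar>deriv H x\<bar> \<le> 1 / m"
      by (rule inverse_bounded_derivs[OF hf(1) assms(1) m0 m_le_h]) (rule that)
    obtain F where F: "\<And>x. f (F x) = x" "\<And>x. F (f x) = x" "bounded_derivs n F" "\<And>x. \<bar>deriv F x\<bar> \<le> 1 / \<alpha>"
      by (rule inverse_bounded_derivs[OF hf(2) assms(1,3) \<alpha>_le_f]) (rule that)
    have g: "bounded_C n g"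
      unfolding bounded_C_def bounded_derivs_def
      using gC g_le bounded_range_iff_abs[THEN iffD2] by blast
    have dg: "\<bar>deriv g x\<bar> \<le> \<beta>" for x
      using bspec[OF g_le, of 1] assms(1) by simp
    have FA: "\<bar>deriv F x\<bar> \<le> A" for x
      using F(4)[of x] A(2) by simp
    have ball: "A * (L * L + \<beta>) \<le> L"
    proof -
      have "A * (L * L + \<beta>) = (L * A) * L + A * \<beta>"
        by (simp add: algebra_simps)
      also have "\<dots> \<le> 1 / 4 * L + A * \<beta>0"
        using LA1 L A \<beta> by (intro add_mono mult_right_mono mult_left_mono) auto
      also have "\<dots> \<le> L"
        using \<beta>0(2) L by simp
      finally show ?thesis .
    qed
    have m: "1 / m \<le> 1" "0 \<le> 1 / m"
      using assms by auto
    have m_le: "1 / m * y \<le> y" if "0 \<le> y" for y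
      using mult_right_mono[OF m(1) that] by simp
    have n1: "Suc 0 \<le> n"
      using assms(1) by simp
    obtain \<phi> where eq: "\<And>x. \<phi> x = H (\<phi> (\<phi> (F x)) - g (F x))" and \<phi>: "bounded (range \<phi>)"
      "bounded_derivs (Suc 0) \<phi>" "\<And>x. \<bar>deriv \<phi> x\<bar> \<le> L"
    proof (rule C1_solution_of_functional_equation[OF q(1) _ m(2) _ bounded_derivs_mono[OF H(3) n1] H(4)
        bounded_derivs_mono[OF F(3) n1] FA bounded_C_mono[OF g n1] dg q(3)])
      show "1 / m * A * (L * L + \<beta>) \<le> L"
        using m_le[of "A * (L * L + \<beta>)"] ball A L \<beta> by (simp add: mult.assoc)
      show "1 / m * A * (2 * L) \<le> q"
        using m_le[of "A * (2 * L)"] LA1 q(2) A L by (simp add: mult.assoc mult.commute mult.left_commute)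
      show "0 \<le> L" "0 \<le> A"
        using L A by simp_all
    qed (rule that)
    have "bounded_derivs n \<phi>"
    proof (rule solution_regularity[OF A(1) _ _ _ q(1) ball H(3) _ F(3) FA g dg eq \<phi>(2,3) assms(1) order_refl])
      show "2 * L * A * A ^ n \<le> q"
        using LAn q(2) by simp
      show "\<bar>deriv H x\<bar> \<le> 1" for x
        using H(4)[of x] m(1) by linarith
    qed (use L LA0 in auto)
    \<comment> \<open>At \<open>f x\<close> the inner \<open>F\<close> cancels, and applying
      \<open>h\<close> removes \<open>H\<close>.\<close>
    moreover have "\<phi> (\<phi> x) = h (\<phi> (f x)) + g x" for x
      by (subst eq[of "f x"]) (simp add: F(2) H(1))
    ultimately show "\<exists>\<phi> :: real \<Rightarrow> real.
          C_class n \<phi> \<and> bounded (range \<phi>) \<and>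
          (\<forall>k\<in>{1..n}. bounded (range ((deriv ^^ k) \<phi>))) \<and>
          (\<forall>x. \<phi> (\<phi> x) = h (\<phi> (f x)) + g x)"
      using \<phi>(1) unfolding bounded_derivs_def by blast
  qed
qed

end
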